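(* Let $N,N'\ge 1$, $0\le s\le N$, $0\le s'\le N'$ be integers, and let $(D,\omega_D)$ be a Kähler submanifold of $\mathbb{C}^{N,s}$. Then no non-empty open subset of $D$ (with the metric $\omega_D$) can be a Kähler submanifold of $\mathbb{CP}^{N'}_{s'}(b)$ (for any $b>0$) or of $\mathbb{CH}^{N'}_{s'}(b)$ (for any $b<0$). In other words, $\mathbb{C}^{N,s}$ and $\mathbb{CP}^{N'}_{s'}(b)$ (respectively $\mathbb{CH}^{N'}_{s'}(b)$) cannot be relatives.
   Context: The indefinite complex Euclidean space $\mathbb{C}^{N,s}$ ($0\le s\le N$) is $\mathbb{C}^N$ with the indefinite Kähler metric $$\omega_{\mathbb{C}^{N,s}}=\sqrt{-1}\,\partial\bar\partial\left(\sum_{i=1}^{N-s}|z_i|^2-\sum_{j=1}^{s}|z_{N-s+j}|^2\right).$$ For $b>0$, the indefinite complex projective space $\mathbb{CP}^N_s(b)$ ($0\le s\le N$) is the open submanifold $\{(\xi_0,\dots,\xi_N)\in\mathbb{C}^{N+1}:\sum_{i=0}^{N-s}|\xi_i|^2-\sum_{j=0}^{s-1}|\xi_{N-j}|^2>0\}/\mathbb{C}^*$ of $\mathbb{CP}^N$ with the indefinite Kähler metric $$\omega_{\mathbb{CP}^N_s(b)}=\frac{\sqrt{-1}}{b}\partial\bar\partial\log\left(\sum_{i=0}^{N-s}|\xi_i|^2-\sum_{j=0}^{s-1}|\xi_{N-j}|^2\right).$$ For $b<0$, the indefinite complex hyperbolic space $\mathbb{CH}^N_s(b)$ ($0\le s\le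 N$) is the complex manifold underlying $\mathbb{CP}^N_{N-s}(-b)$ with the indefinite Kähler metric $$\omega_{\mathbb{CH}^N_s(b)}=-\frac{\sqrt{-1}}{(-b)}\partial\bar\partial\log\left(\sum_{i=0}^{s}|\xi_i|^2-\sum_{j=0}^{N-s-1}|\xi_{N-j}|^2\right).$$ A Kähler submanifold of an (indefinite) Kähler manifold $(X,\omega_X)$ is a complex manifold $D$ of positive dimension with a (possibly indefinite, non-degenerate) Kähler metric $\omega_D$ together with a holomorphic immersion $F:D\to X$ such that $F^*\omega_X=\omega_D$. Two (indefinite) Kähler manifolds are called relatives when they share a common Kähler submanifold, i.e. a complex submanifold of one of them endowed with the induced metric is biholomorphically isometric to a complex submanifold of the other endowed with the induced metric. *)

theory Defs
  imports "HOL-Analysis.Analysis"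
begin

definition holomorphic_map_on :: "(complex^'n \<Rightarrow> complex^'m) \<Rightarrow> (complex^'n) set \<Rightarrow> bool"
  where "holomorphic_map_on f S \<longleftrightarrow>
    (\<forall>z\<in>S. \<exists>f'. (f has_derivative f') (at z) \<and> (\<forall>c v. f' (c *s v) = c *s f' v))"

primrec Ck_on :: "nat \<Rightarrow> 'a::real_normed_vector set \<Rightarrow> ('a \<Rightarrow> 'b::real_normed_vector) \<Rightarrow> bool"
  where
    "Ck_on 0 S f \<longleftrightarrow> continuous_on S f"
  | "Ck_on (Suc k) S f \<longleftrightarrow> (\<forall>x\<in>S. f differentiable (at x)) \<and>
       (\<forall>v. Ck_on k S (\<lambda>x. frechet_derivative f (at x) v))"

definition smooth_on :: "'a::real_normed_vector set \<Rightarrow> ('a \<Rightarrow> 'b::real_normed_vector) \<Rightarrow> bool"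
  where "smooth_on S f \<longleftrightarrow> (\<forall>k. Ck_on k S f)"

text \<open>The Wirtinger operators \<open>\<partial>/\<partial>z\<^sub>j\<close> and \<open>\<partial>/\<partial>\<close>\<open>conj z\<^sub>j\<close>.\<close>

definition wirtinger :: "'n \<Rightarrow> (complex^'n \<Rightarrow> complex) \<Rightarrow> complex^'n \<Rightarrow> complex"
  where "wirtinger j f z =
    (frechet_derivative f (at z) (axis j 1) - \<i> * frechet_derivative f (at z) (axis j \<i>)) / 2"

definition wirtinger_bar :: "'n \<Rightarrow> (complex^'n \<Rightarrow> complex) \<Rightarrow> complex^'n \<Rightarrow> complex"
  where "wirtinger_bar j f z =
    (frechet_derivative f (at z) (axis j 1) + \<i> * frechet_derivative f (at z) (axis j \<i>)) / 2"

text \<open>Differential two-forms on open subsets of \<open>\<complex>\<^sup>n\<close> are complex-valued functions of a point and two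
  tangent vectors.  With \<open>(dz\<^sub>j \<and> d conj z\<^sub>k)(u, v) = u\<^sub>j * conj v\<^sub>k - v\<^sub>j * conj u\<^sub>k\<close>, the following is
  \<open>\<i> \<partial>\<partial>bar f = \<i> \<Sum>\<^sub>j\<^sub>k (\<partial>\<^sup>2f / \<partial>z\<^sub>j \<partial> conj z\<^sub>k) dz\<^sub>j \<and> d conj z\<^sub>k\<close>.\<close>

definition i_ddbar :: "(complex^'n \<Rightarrow> complex) \<Rightarrow> complex^'n \<Rightarrow> complex^'n \<Rightarrow> complex^'n \<Rightarrow> complex"
  where "i_ddbar f z u v = \<i> * (\<Sum>j\<in>UNIV. \<Sum>k\<in>UNIV.
    wirtinger j (wirtinger_bar k f) z * (u $ j * cnj (v $ k) - v $ j * cnj (u $ k)))"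

text \<open>A non-degenerate, real, closed, smooth \<open>(1,1)\<close>-form on an open set; no positivity is required.\<close>

definition indefinite_kahler_form_on ::
    "(complex^'n) set \<Rightarrow> (complex^'n \<Rightarrow> complex^'n \<Rightarrow> complex^'n \<Rightarrow> complex) \<Rightarrow> bool"
  where "indefinite_kahler_form_on S \<omega> \<longleftrightarrow>
    (\<forall>u v. smooth_on S (\<lambda>z. \<omega> z u v)) \<and>
    (\<forall>z\<in>S.
      bilinear (\<omega> z) \<and>
      (\<forall>u v. \<omega> z u v \<in> \<real>) \<and>
      (\<forall>u v. \<omega> z u v = - \<omega> z v u) \<and>
      (\<forall>u v. \<omega> z (\<i> *s u) (\<i> *s v) = \<omega> z u v) \<and>
      (\<forall>u. (\<forall>v. \<omega> z u v = 0) \<longrightarrow> u = 0) \<and>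
      (\<forall>u v w. frechet_derivative (\<lambda>y. \<omega> y v w) (at z) u
             + frechet_derivative (\<lambda>y. \<omega> y w u) (at z) v
             + frechet_derivative (\<lambda>y. \<omega> y u v) (at z) w = 0))"

text \<open>The atlas is indexed by the type \<open>'i\<close>, and chart \<open>i\<close> is the restriction of \<open>coord M i\<close> to
  \<open>dom M i\<close> (possibly empty).  The two-form is given by its expression \<open>form M i\<close> in each chart, a
  function of the chart coordinate.  The dimension \<open>CARD('n)\<close> is positive.\<close>

record ('p, 'i, 'n::finite) kmfd =
  topo :: "'p topology"
  dom :: "'i \<Rightarrow> 'p set"
  coord :: "'i \<Rightarrow> 'p \<Rightarrow> complex^'n"
  form :: "'i \<Rightarrow> complex^'n \<Rightarrow> complex^'n \<Rightarrow> complex^'n \<Rightarrow> complex"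

abbreviation points :: "('p, 'i, 'n::finite) kmfd \<Rightarrow> 'p set"
  where "points M \<equiv> topspace (topo M)"

definition coord_rep :: "('p, 'i, 'n::finite) kmfd \<Rightarrow> ('q, 'j, 'm::finite) kmfd \<Rightarrow> ('p \<Rightarrow> 'q) \<Rightarrow>
    'i \<Rightarrow> 'j \<Rightarrow> complex^'n \<Rightarrow> complex^'m"
  where "coord_rep M X F i j = coord X j \<circ> F \<circ> inv_into (dom M i) (coord M i)"

definition rep_dom :: "('p, 'i, 'n::finite) kmfd \<Rightarrow> ('q, 'j, 'm::finite) kmfd \<Rightarrow> ('p \<Rightarrow> 'q) \<Rightarrow>
    'i \<Rightarrow> 'j \<Rightarrow> (complex^'n) set"
  where "rep_dom M X F i j = coord M i ` {p \<in> dom M i. F p \<in> dom X j}"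

definition holomorphic_charts :: "('p, 'i, 'n::finite) kmfd \<Rightarrow> ('q, 'j, 'm::finite) kmfd \<Rightarrow>
    ('p \<Rightarrow> 'q) \<Rightarrow> bool"
  where "holomorphic_charts M X F \<longleftrightarrow>
    (\<forall>i j. holomorphic_map_on (coord_rep M X F i j) (rep_dom M X F i j))"

text \<open>\<open>F\<^sup>* (form X) = form M\<close>\<close>

definition pulls_back_form :: "('p, 'i, 'n::finite) kmfd \<Rightarrow> ('q, 'j, 'm::finite) kmfd \<Rightarrow>
    ('p \<Rightarrow> 'q) \<Rightarrow> bool"
  where "pulls_back_form M X F \<longleftrightarrow>
    (\<forall>i j. \<forall>z \<in> rep_dom M X F i j. \<forall>u v.
      form X j (coord_rep M X F i j z)
        (frechet_derivative (coord_rep M X F i j) (at z) u)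
        (frechet_derivative (coord_rep M X F i j) (at z) v)
      = form M i z u v)"

definition complex_manifold :: "('p, 'i, 'n::finite) kmfd \<Rightarrow> bool"
  where "complex_manifold M \<longleftrightarrow>
    Hausdorff_space (topo M) \<and> second_countable (topo M) \<and>
    points M = (\<Union>i. dom M i) \<and>
    (\<forall>i. openin (topo M) (dom M i) \<and> open (coord M i ` dom M i) \<and>
         homeomorphic_map (subtopology (topo M) (dom M i))
           (top_of_set (coord M i ` dom M i)) (coord M i)) \<and>
    holomorphic_charts M M id"

text \<open>The last conjunct says that the local expressions of the form agree on overlaps of charts.\<close>

definition indefinite_kahler_manifold :: "('p, 'i, 'n::finite) kmfd \<Rightarrow> bool"
  where "indefinite_kahler_manifold M \<longleftrightarrow>
    complex_manifold M \<and>
    (\<forall>i. indefinite_kahler_form_on (coord M i ` dom M i) (form M i)) \<and>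
    pulls_back_form M M id"

definition holomorphic_immersion :: "('p, 'i, 'n::finite) kmfd \<Rightarrow> ('q, 'j, 'm::finite) kmfd \<Rightarrow>
    ('p \<Rightarrow> 'q) \<Rightarrow> bool"
  where "holomorphic_immersion M X F \<longleftrightarrow>
    continuous_map (topo M) (topo X) F \<and>
    holomorphic_charts M X F \<and>
    (\<forall>i j. \<forall>z \<in> rep_dom M X F i j. inj (frechet_derivative (coord_rep M X F i j) (at z)))"

definition kahler_submanifold :: "('p, 'i, 'n::finite) kmfd \<Rightarrow> ('q, 'j, 'm::finite) kmfd \<Rightarrow>
    ('p \<Rightarrow> 'q) \<Rightarrow> bool"
  where "kahler_submanifold D X F \<longleftrightarrow>
    indefinite_kahler_manifold D \<and> holomorphic_immersion D X F \<and> pulls_back_form D X F"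

definition restrict_kmfd :: "('p, 'i, 'n::finite) kmfd \<Rightarrow> 'p set \<Rightarrow> ('p, 'i, 'n) kmfd"
  where "restrict_kmfd M U =
    M\<lparr>topo := subtopology (topo M) U, dom := (\<lambda>i. dom M i \<inter> U)\<rparr>"

text \<open>The common submanifold has points in \<open>'p\<close>, charts indexed by \<open>'i\<close> and dimension \<open>CARD('n)\<close>;
  HOL cannot quantify over these types inside a definition, so they are a parameter.\<close>

definition relatives :: "('p, 'i, 'n::finite) kmfd itself \<Rightarrow>
    ('q, 'j, 'm::finite) kmfd \<Rightarrow> ('r, 'k, 'l::finite) kmfd \<Rightarrow> bool"
  where "relatives T X Y \<longleftrightarrow>
    (\<exists>D :: ('p, 'i, 'n) kmfd. points D \<noteq> {} \<and>
      (\<exists>F. kahler_submanifold D X F) \<and> (\<exists>G. kahler_submanifold D Y G))"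

text \<open>A fixed numbering \<open>1, \<dots>, N\<close> of the coordinates of \<open>complex^'n\<close>, where \<open>N = CARD('n)\<close>.\<close>

definition coord_num :: "'n::finite \<Rightarrow> nat"
  where "coord_num = (SOME e. bij_betw e UNIV {1..CARD('n)})"

lemma bij_betw_coord_num: "bij_betw (coord_num :: 'n::finite \<Rightarrow> nat) UNIV {1..CARD('n)}"
proof -
  have "\<exists>e :: 'n \<Rightarrow> nat. bij_betw e UNIV {1..CARD('n)}"
    using finite_same_card_bij[of "UNIV :: 'n set" "{1..CARD('n)}"] by auto
  then show ?thesis
    unfolding coord_num_def by (rule someI_ex)
qed

definition euclidean_form :: "nat \<Rightarrow> complex^'n \<Rightarrow> real"
  where "euclidean_form s z =
    (\<Sum>i | coord_num i \<le> CARD('n) - s. (cmod (z $ i))\<^sup>2)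
    - (\<Sum>i | coord_num i > CARD('n) - s. (cmod (z $ i))\<^sup>2)"

definition complex_euclidean :: "nat \<Rightarrow> (complex^'n, unit, 'n::finite) kmfd"
  where "complex_euclidean s =
    \<lparr>topo = euclidean, dom = (\<lambda>_. UNIV), coord = (\<lambda>_ z. z),
     form = (\<lambda>_. i_ddbar (\<lambda>z. of_real (euclidean_form s z)))\<rparr>"

text \<open>Homogeneous coordinates \<open>\<xi>\<^sub>0, \<dots>, \<xi>\<^sub>N\<close> are indexed by \<open>'n option\<close>, with \<open>None\<close> for \<open>\<xi>\<^sub>0\<close>.\<close>

definition hcoord_num :: "'n::finite option \<Rightarrow> nat"
  where "hcoord_num l = (case l of None \<Rightarrow> 0 | Some i \<Rightarrow> coord_num i)"

definition homogeneous_form :: "nat \<Rightarrow> complex^('n::finite option) \<Rightarrow> real"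
  where "homogeneous_form s \<xi> =
    (\<Sum>l | hcoord_num l \<le> CARD('n) - s. (cmod (\<xi> $ l))\<^sup>2)
    - (\<Sum>l | hcoord_num l > CARD('n) - s. (cmod (\<xi> $ l))\<^sup>2)"

definition proj_class :: "complex^'k \<Rightarrow> (complex^'k) set"
  where "proj_class \<xi> = {c *s \<xi> | c. c \<noteq> 0}"

definition proj_points :: "nat \<Rightarrow> (complex^('n::finite option)) set set"
  where "proj_points s = proj_class ` {\<xi>. homogeneous_form s \<xi> > 0}"

definition proj_topology :: "nat \<Rightarrow> (complex^('n::finite option)) set topology"
  where "proj_topology s = topology (\<lambda>U. U \<subseteq> proj_points s \<and>
    open {\<xi>. homogeneous_form s \<xi> > 0 \<and> proj_class \<xi> \<in> U})"

lemma openin_proj_topology: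
  fixes U :: "(complex^('n::finite option)) set set"
  shows "openin (proj_topology s) U \<longleftrightarrow> U \<subseteq> proj_points s \<and>
    open {\<xi>. homogeneous_form s \<xi> > 0 \<and> proj_class \<xi> \<in> U}"
proof -
  have "istopology (\<lambda>U. U \<subseteq> proj_points s \<and>
      open {\<xi> :: complex^('n option). homogeneous_form s \<xi> > 0 \<and> proj_class \<xi> \<in> U})"
    unfolding istopology_def
  proof (intro conjI allI impI)
    fix A B :: "(complex^('n option)) set set"
    assume A: "A \<subseteq> proj_points s \<and> open {\<xi>. homogeneous_form s \<xi> > 0 \<and> proj_class \<xi> \<in> A}"
      and B: "B \<subseteq> proj_points s \<and> open {\<xi>. homogeneous_form s \<xi> > 0 \<and> proj_class \<xi> \<in> B}"
    show "A \<inter> B \<subseteq> proj_points s" using A by auto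
    have "{\<xi>. homogeneous_form s \<xi> > 0 \<and> proj_class \<xi> \<in> A \<inter> B} =
      {\<xi>. homogeneous_form s \<xi> > 0 \<and> proj_class \<xi> \<in> A} \<inter>
      {\<xi>. homogeneous_form s \<xi> > 0 \<and> proj_class \<xi> \<in> B}" by auto
    then show "open {\<xi>. homogeneous_form s \<xi> > 0 \<and> proj_class \<xi> \<in> A \<inter> B}"
      using A B by auto
  next
    fix K :: "(complex^('n option)) set set set"
    assume K: "\<forall>A\<in>K. A \<subseteq> proj_points s \<and>
      open {\<xi>. homogeneous_form s \<xi> > 0 \<and> proj_class \<xi> \<in> A}"
    show "\<Union>K \<subseteq> proj_points s" using K by auto
    have "{\<xi>. homogeneous_form s \<xi> > 0 \<and> proj_class \<xi> \<in> \<Union>K} =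
      (\<Union>A\<in>K. {\<xi>. homogeneous_form s \<xi> > 0 \<and> proj_class \<xi> \<in> A})" by auto
    then show "open {\<xi>. homogeneous_form s \<xi> > 0 \<and> proj_class \<xi> \<in> \<Union>K}"
      using K by auto
  qed
  then show ?thesis
    unfolding proj_topology_def by (simp add: topology_inverse')
qed

text \<open>Affine chart \<open>l\<close> lives on \<open>\<xi>\<^sub>l \<noteq> 0\<close> and lists the quotients \<open>\<xi>\<^sub>m / \<xi>\<^sub>l\<close> with \<open>m \<noteq> l\<close>.  They are
  indexed by \<open>'n\<close> through \<open>m = Some i\<close>, except that \<open>\<xi>\<^sub>0 / \<xi>\<^sub>l\<close> takes the place left free by \<open>m = l\<close>.\<close>

definition affine_coord :: "'n::finite option \<Rightarrow> complex^('n option) \<Rightarrow> complex^'n"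
  where "affine_coord l \<xi> = (\<chi> i. \<xi> $ (if l = Some i then None else Some i) / \<xi> $ l)"

text \<open>The representative of a point of chart \<open>l\<close> normalised by \<open>\<xi>\<^sub>l = 1\<close>.\<close>

definition affine_lift :: "'n::finite option \<Rightarrow> complex^'n \<Rightarrow> complex^('n option)"
  where "affine_lift l w = (\<chi> m. if m = l then 1
    else case m of None \<Rightarrow> w $ (the l) | Some i \<Rightarrow> w $ i)"

text \<open>The form \<open>(\<i>/b) \<partial>\<partial>bar log (homogeneous_form s)\<close> on the cone descends to the quotient; its
  expression in an affine chart is obtained by inserting the normalised representative.\<close>

definition complex_projective ::
    "nat \<Rightarrow> real \<Rightarrow> ((complex^('n option)) set, 'n option, 'n::finite) kmfd"
  where "complex_projective s b =
    \<lparr>topo = proj_topology s,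
     dom = (\<lambda>l. {P \<in> proj_points s. \<forall>\<xi>\<in>P. \<xi> $ l \<noteq> 0}),
     coord = (\<lambda>l P. affine_coord l (SOME \<xi>. \<xi> \<in> P)),
     form = (\<lambda>l w u v. of_real (1 / b) *
       i_ddbar (\<lambda>w. of_real (ln (homogeneous_form s (affine_lift l w)))) w u v)\<rparr>"

definition complex_hyperbolic ::
    "nat \<Rightarrow> real \<Rightarrow> ((complex^('n option)) set, 'n option, 'n::finite) kmfd"
  where "complex_hyperbolic s b =
    (complex_projective (CARD('n) - s) (- b))
      \<lparr>form := (\<lambda>l w u v. - of_real (1 / (- b)) *
        i_ddbar (\<lambda>w. of_real (ln (homogeneous_form (CARD('n) - s) (affine_lift l w)))) w u v)\<rparr>"

end

theory Submission
  imports Defs "HOL-Complex_Analysis.Cauchy_Integral_Formula" "HOL-Library.Function_Algebras"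
begin

text \<open>Restrict to a complex line \<open>t \<mapsto> z + t e\<close> in a chart of the common submanifold; let \<open>f\<close> be the
  flat map and \<open>g\<close> a lift of the projective one along it, and \<open>K(t, s) = \<langle>g t, g s\<rangle>\<close>.  Equality of the
  metrics, polarised in \<open>t\<close> and \<open>cnj t\<close>, gives \<open>\<partial>\<^sub>t K = \<phi> K\<close> where both \<open>K\<close> and
  \<open>\<phi>(t, s) = b \<langle>f' t, f s\<rangle> + \<gamma> t\<close> are finite sums of products of a function of \<open>t\<close> and one of \<open>s\<close>.
  As \<open>K\<close> has finite rank, the derivatives \<open>\<partial>\<^sub>t\<^sup>k K(t, \<cdot>)\<close> are linearly dependent, so some power
  \<open>\<phi>(t, \<cdot>)\<^sup>d\<close> is a polynomial of degree less than \<open>d\<close> in a basis of the span of the \<open>\<phi>(t, \<cdot>)\<close>.  This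
  holds for all \<open>t\<close>, hence for that basis, which therefore generates a finite-dimensional algebra of
  functions.  So every \<open>\<phi>(t, \<cdot>)\<close> has finitely many values, is constant, and \<open>\<langle>f' t, f' t\<rangle> = 0\<close>.  As the
  direction \<open>e\<close> is arbitrary, the metric would vanish.\<close>

section \<open>Functions with monic polynomial relations\<close>

text \<open>Complex scaling of functions; the interpretation below supplies span, independence,
  bases and coordinates for function spaces.\<close>

definition fscale :: "complex \<Rightarrow> ('w \<Rightarrow> complex) \<Rightarrow> 'w \<Rightarrow> complex"
  where "fscale c f = (\<lambda>s. c * f s)"

interpretation fs: vector_space fscale
  by unfold_locales (auto simp: fscale_def fun_eq_iff algebra_simps)

lemma sum_fun_apply: "(\<Sum>i\<in>I. f i) s = (\<Sum>i\<in>I. f i s)" for f :: "'i \<Rightarrow> 'w \<Rightarrow> complex"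
  by (induction I rule: infinite_finite_induct) auto

text \<open>Listing the factors makes the degree \<open>length xs\<close> and multiplication
  \<open>@\<close>; \<open>monomial_cong_mset\<close> restores commutativity.\<close>

definition monomial :: "('w \<Rightarrow> complex) list \<Rightarrow> 'w \<Rightarrow> complex"
  where "monomial xs s = (\<Prod>l\<leftarrow>xs. l s)"

lemma monomial_simps [simp]:
  "monomial [] s = 1" "monomial (l # xs) s = l s * monomial xs s"
  "monomial (xs @ ys) s = monomial xs s * monomial ys s"
  "monomial (replicate k l) s = l s ^ k"
  by (simp_all add: monomial_def)

lemma monomial_cong_mset: "mset xs = mset ys \<Longrightarrow> monomial xs = monomial ys"
  unfolding monomial_def fun_eq_iff
  by (simp flip: prod_mset_prod_list)

text \<open>Functions that are polynomials of degree less than \<open>k\<close> in \<open>L\<close>.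
  The strict bound lets a monic relation for \<open>l\<close> be written as \<open>l ^ d\<close>
  lying in \<open>poly_span L d\<close>.\<close>

definition poly_span :: "('w \<Rightarrow> complex) set \<Rightarrow> nat \<Rightarrow> ('w \<Rightarrow> complex) set"
  where "poly_span L k = fs.span (monomial ` {xs. set xs \<subseteq> L \<and> length xs < k})"

lemma monomial_in_poly_span: "set xs \<subseteq> L \<Longrightarrow> length xs < k \<Longrightarrow> monomial xs \<in> poly_span L k"
  unfolding poly_span_def by (intro fs.span_base) auto

lemma poly_span_mult_monomial:
  assumes f: "f \<in> poly_span L j" and ys: "set ys \<subseteq> L"
  shows "(\<lambda>s. f s * monomial ys s) \<in> poly_span L (j + length ys)"
  using f unfolding poly_span_def[of L j]
proof (induction rule: fs.span_induct_alt)
  case base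
  have "(\<lambda>s. 0 s * monomial ys s) = 0" by auto
  then show ?case by (simp add: poly_span_def fs.span_zero)
next
  case (step c x y)
  then obtain xs where xs: "x = monomial xs" "set xs \<subseteq> L" "length xs < j" by auto
  have "monomial (xs @ ys) \<in> poly_span L (j + length ys)"
    using xs ys by (intro monomial_in_poly_span) auto
  then have "fscale c (monomial (xs @ ys)) + (\<lambda>s. y s * monomial ys s) \<in> poly_span L (j + length ys)"
    using step unfolding poly_span_def by (intro fs.span_add fs.span_scale)
  also have "fscale c (monomial (xs @ ys)) + (\<lambda>s. y s * monomial ys s) =
     (\<lambda>s. (fscale c x + y) s * monomial ys s)"
    by (auto simp: fscale_def xs algebra_simps)
  finally show ?case .
qed

text \<open>Otherwise every initial segment of \<open>V\<close> would be independent, and one of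
  length \<open>card T + 1\<close> does not fit into the span of \<open>T\<close>.\<close>

lemma exists_in_span_of_previous:
  fixes V :: "nat \<Rightarrow> 'w \<Rightarrow> complex"
  assumes T: "finite T" and V: "\<And>k. V k \<in> fs.span T"
  shows "\<exists>d. V d \<in> fs.span (V ` {..<d})"
proof (rule ccontr)
  assume *: "\<nexists>d. V d \<in> fs.span (V ` {..<d})"
  \<comment> \<open>The cardinality is carried along because independence of the image set does not
    exclude repetitions.\<close>
  have "fs.independent (V ` {..<n}) \<and> card (V ` {..<n}) = n" for n
  proof (induction n)
    case (Suc n)
    have "V n \<notin> fs.span (V ` {..<n})" using * by blast
    moreover from this have "V n \<notin> V ` {..<n}" by (rule contrapos_nn) (rule fs.span_base)
    ultimately show ?case using Suc
      by (simp add: lessThan_Suc fs.independent_insert)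
  qed (simp add: fs.independent_empty)
  then have "fs.independent (V ` {..<Suc (card T)})" "card (V ` {..<Suc (card T)}) = Suc (card T)"
    by blast+
  then show False
    using fs.independent_span_bound[OF T, of "V ` {..<Suc (card T)}"] V by auto
qed

lemma finite_monomial_lists: "finite L \<Longrightarrow> finite {xs. set xs \<subseteq> L \<and> length xs < k}"
  by (rule finite_subset[OF _ finite_lists_length_le[of L k]]) auto

text \<open>The points at infinity of the image of \<open>L\<close> are cut out by the equations \<open>l ^ D = 0\<close>, so there are
  none and the image is a finite set.\<close>

lemma finite_range_if_powers_reduce:
  assumes L: "finite L" and red: "\<And>l. l \<in> L \<Longrightarrow> (\<lambda>s. l s ^ D) \<in> poly_span L D" and x: "x \<in> L"
  shows "finite (range x)"
proof -
  define N where "N = Suc (card L * D)"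
  \<comment> \<open>By pigeonhole some \<open>l\<close> occurs at least \<open>D\<close> times in a
    monomial of degree \<open>N\<close> or more; replacing \<open>l ^ D\<close> by its reduction
    lowers the degree.\<close>
  have lower: "monomial xs \<in> poly_span L (length xs)" if xs: "set xs \<subseteq> L" "length xs \<ge> N" for xs
  proof -
    have "\<exists>l\<in>L. count (mset xs) l \<ge> D"
    proof (rule ccontr)
      assume no: "\<not> ?thesis"
      have "count (mset xs) l \<le> D" if "l \<in> L" for l
        using no that by (simp add: not_le less_imp_le)
      then have "(\<Sum>l\<in>L. count (mset xs) l) \<le> card L * D"
        using sum_bounded_above[of L "count (mset xs)" D] by simp
      moreover have "length xs = (\<Sum>l\<in>L. count (mset xs) l)"
        using sum.mono_neutral_left[OF L, of "set xs" "count (mset xs)"] xs(1)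
        by (simp add: size_multiset_overloaded_eq flip: size_mset)
      ultimately show False using xs(2) by (simp add: N_def)
    qed
    then obtain l where l: "l \<in> L" "count (mset xs) l \<ge> D" by blast
    then have "replicate_mset D l \<subseteq># mset xs" by (simp add: count_le_replicate_mset_subset_eq)
    then obtain B where B: "mset xs = replicate_mset D l + B" by (metis subset_mset.less_eqE)
    obtain ys where ys: "mset ys = B" using ex_mset by blast
    have m: "mset xs = mset (replicate D l @ ys)" using B ys by simp
    have sy: "set ys \<subseteq> L" using mset_eq_setD[OF m] xs(1) by auto
    have len: "length xs = D + length ys" using mset_eq_length[OF m] by simp
    have "(\<lambda>s. l s ^ D * monomial ys s) \<in> poly_span L (D + length ys)"
      using poly_span_mult_monomial[OF red[OF l(1)] sy] .
    also have "(\<lambda>s. l s ^ D * monomial ys s) = monomial xs"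
      using monomial_cong_mset[OF m] by (auto simp: fun_eq_iff)
    finally show ?thesis using len by simp
  qed
  \<comment> \<open>Iterated lowering ends below degree \<open>N\<close>, so finitely many monomials
    span the whole algebra generated by \<open>L\<close>.\<close>
  have all: "monomial xs \<in> poly_span L N" if "set xs \<subseteq> L" for xs
    using that
  proof (induction xs rule: length_induct)
    case (1 xs)
    show ?case
    proof (cases "length xs < N")
      case True
      then show ?thesis using 1 by (intro monomial_in_poly_span)
    next
      case False
      then have "monomial xs \<in> poly_span L (length xs)" using lower 1 by auto
      moreover have "poly_span L (length xs) \<subseteq> poly_span L N"
        unfolding poly_span_def[of L "length xs"]
        by (rule fs.span_minimal) (use 1 in \<open>auto simp: poly_span_def\<close>)
      ultimately show ?thesis by blast
    qed
  qed
  have "(\<lambda>s. x s ^ k) \<in> poly_span L N" for k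
  proof -
    have "monomial (replicate k x) = (\<lambda>s. x s ^ k)" by (simp add: fun_eq_iff)
    then show ?thesis using all[of "replicate k x"] x
      by (metis in_set_replicate subsetI)
  qed
  \<comment> \<open>The powers of \<open>x\<close> lie in a finite-dimensional space, so some power
    depends on the earlier ones: \<open>x\<close> satisfies a monic polynomial at every
    point.\<close>
  then obtain d where d: "(\<lambda>s. x s ^ d) \<in> fs.span ((\<lambda>k s. x s ^ k) ` {..<d})"
    using exists_in_span_of_previous[of "monomial ` {xs. set xs \<subseteq> L \<and> length xs < N}" "\<lambda>k s. x s ^ k"]
      finite_monomial_lists[OF L] unfolding poly_span_def by auto
  \<comment> \<open>A vanishing coefficient at \<open>d\<close> suffices in place of a degree bound:
    it already makes \<open>monom 1 d - q\<close> a nonzero polynomial.\<close>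
  have "\<exists>q. coeff q d = 0 \<and> (\<forall>s. v s = poly q (x s))"
    if "v \<in> fs.span ((\<lambda>k s. x s ^ k) ` {..<d})" for v
    using that
  proof (induction rule: fs.span_induct_alt)
    case base
    then show ?case by (intro exI[of _ 0]) auto
  next
    case (step c u v)
    then obtain q k where q: "coeff q d = 0" "\<forall>s. v s = poly q (x s)"
      and k: "u = (\<lambda>s. x s ^ k)" "k < d" by auto
    show ?case
      by (rule exI[of _ "monom c k + q"]) (use q k in \<open>auto simp: fscale_def poly_monom\<close>)
  qed
  from this[OF d] obtain q where q: "coeff q d = 0" "\<And>s. x s ^ d = poly q (x s)" by auto
  have "coeff (monom 1 d - q) d = 1" using q(1) by simp
  then have "monom 1 d - q \<noteq> 0" by fastforce
  then have "finite {z. poly (monom 1 d - q) z = 0}" by (rule poly_roots_finite)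
  moreover have "range x \<subseteq> {z. poly (monom 1 d - q) z = 0}"
    using q(2) by (auto simp: poly_monom)
  ultimately show ?thesis by (rule finite_subset[rotated])
qed

section \<open>Logarithmic derivatives of functions of finite rank\<close>

text \<open>Polynomials of degree less than \<open>k\<close> in \<open>L\<close> whose coefficients
  are holomorphic in \<open>t\<close>. Building them term by term makes each closure property a rule
  induction.\<close>

inductive poly_family ::
    "complex set \<Rightarrow> ('w \<Rightarrow> complex) set \<Rightarrow> nat \<Rightarrow> (complex \<Rightarrow> 'w \<Rightarrow> complex) \<Rightarrow> bool"
  for B L k where
  zero: "poly_family B L k (\<lambda>t s. 0)"
| step: "h holomorphic_on B \<Longrightarrow> set xs \<subseteq> L \<Longrightarrow> length xs < k \<Longrightarrow> poly_family B L k E \<Longrightarrow>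
    poly_family B L k (\<lambda>t s. h t * monomial xs s + E t s)"

lemma poly_family_mono: "poly_family B L j E \<Longrightarrow> j \<le> k \<Longrightarrow> poly_family B L k E"
  by (induction rule: poly_family.induct) (auto intro: poly_family.intros)

lemma poly_family_add:
  "poly_family B L k E \<Longrightarrow> poly_family B L k E' \<Longrightarrow> poly_family B L k (\<lambda>t s. E t s + E' t s)"
  by (induction rule: poly_family.induct) (auto simp: add.assoc intro: poly_family.intros)

lemma poly_family_mult_linear:
  assumes "poly_family B L k E" "h holomorphic_on B" "l \<in> L"
  shows "poly_family B L (Suc k) (\<lambda>t s. h t * l s * E t s)"
  using assms(1)
proof (induction rule: poly_family.induct)
  case (step h' xs E)
  have "poly_family B L (Suc k) (\<lambda>t s. (h t * h' t) * monomial (l # xs) s + h t * l s * E t s)"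
    using step assms(2,3) by (intro poly_family.step holomorphic_intros) auto
  then show ?case by (simp add: algebra_simps)
qed (simp add: poly_family.zero)

text \<open>\<open>L'\<close> is kept apart from \<open>L\<close> so that the induction can shrink
  the sum while the generators stay fixed.\<close>

lemma poly_family_mult_sum:
  assumes "poly_family B L k E" "finite L'" "L' \<subseteq> L" "\<And>l. l \<in> L' \<Longrightarrow> \<psi> l holomorphic_on B"
  shows "poly_family B L (Suc k) (\<lambda>t s. (\<Sum>l\<in>L'. \<psi> l t * l s) * E t s)"
  using assms(2-4)
proof (induction L' rule: finite_induct)
  case (insert l L')
  have "poly_family B L (Suc k) (\<lambda>t s. \<psi> l t * l s * E t s + (\<Sum>l\<in>L'. \<psi> l t * l s) * E t s)"
    using insert assms(1) by (intro poly_family_add poly_family_mult_linear) auto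
  then show ?case using insert by (simp add: algebra_simps)
qed (simp add: poly_family.zero)

text \<open>Only the coefficients depend on \<open>t\<close>, so differentiating in \<open>t\<close>
  preserves the degree bound.\<close>

lemma poly_family_deriv:
  assumes "open B" "poly_family B L k E"
  shows "\<exists>E'. poly_family B L k E' \<and>
    (\<forall>t\<in>B. \<forall>s. ((\<lambda>t. E t s) has_field_derivative E' t s) (at t))"
  using assms(2)
proof (induction rule: poly_family.induct)
  case zero
  then show ?case by (intro exI[of _ "\<lambda>t s. 0"]) (auto intro: poly_family.zero)
next
  case (step h xs E)
  then obtain E' where E': "poly_family B L k E'"
    "\<forall>t\<in>B. \<forall>s. ((\<lambda>t. E t s) has_field_derivative E' t s) (at t)" by blast
  have "poly_family B L k (\<lambda>t s. deriv h t * monomial xs s + E' t s)"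
    using step E' assms(1) by (intro poly_family.step holomorphic_deriv)
  moreover have "((\<lambda>t. h t * monomial xs s + E t s) has_field_derivative
      deriv h t * monomial xs s + E' t s) (at t)" if "t \<in> B" for t s
    using E'(2) that holomorphic_derivI[OF step(1) assms(1) that]
    by (auto intro!: derivative_eq_intros)
  ultimately show ?case by blast
qed

lemma poly_family_eval:
  assumes "poly_family B L k E"
  shows "E t \<in> poly_span L k"
  using assms
proof (induction rule: poly_family.induct)
  case zero
  then show ?case using fs.span_zero by (simp add: poly_span_def zero_fun_def)
next
  case (step h xs E)
  have "fscale (h t) (monomial xs) + E t \<in> poly_span L k"
    using step monomial_in_poly_span[of xs L k] unfolding poly_span_def
    by (intro fs.span_add fs.span_scale)
  then show ?case by (simp add: fscale_def plus_fun_def)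
qed

text \<open>For each \<open>t\<close> the functions \<open>\<partial>\<^sub>t\<^sup>k K(t, \<cdot>)\<close> lie in the span of the \<open>b i\<close>, hence are linearly
  dependent; dividing a relation by \<open>K\<close> gives a monic polynomial relation for \<open>\<phi>(t, \<cdot>)\<close>.\<close>

lemma log_derivative_power_reduces:
  fixes a :: "'i \<Rightarrow> complex \<Rightarrow> complex" and b :: "'i \<Rightarrow> 'w \<Rightarrow> complex"
    and \<psi> :: "('w \<Rightarrow> complex) \<Rightarrow> complex \<Rightarrow> complex" and L :: "('w \<Rightarrow> complex) set" and I :: "'i set"
  defines "\<phi> \<equiv> \<lambda>t s. \<Sum>l\<in>L. \<psi> l t * l s" and "K \<equiv> \<lambda>t s. \<Sum>i\<in>I. a i t * b i s"
  assumes B: "open B" "t0 \<in> B" and L: "finite L" and I: "finite I"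
    and \<psi>: "\<And>l. l \<in> L \<Longrightarrow> \<psi> l holomorphic_on B"
    and a: "\<And>i. i \<in> I \<Longrightarrow> a i holomorphic_on B"
    and nz: "\<And>t s. t \<in> B \<Longrightarrow> K t s \<noteq> 0"
    and eq: "\<And>t s. t \<in> B \<Longrightarrow> (\<Sum>i\<in>I. deriv (a i) t * b i s) = \<phi> t s * K t s"
  shows "\<exists>d. (\<lambda>s. \<phi> t0 s ^ d) \<in> poly_span L d"
proof -
  have pow: "poly_family B L (Suc k) (\<lambda>t s. \<phi> t s ^ k)" for k
  proof (induction k)
    case 0
    have "poly_family B L 1 (\<lambda>t s. 1 * monomial [] s + 0)"
      by (intro poly_family.intros) auto
    then show ?case by simp
  next
    case (Suc k)
    from poly_family_mult_sum[OF this L order_refl \<psi>] show ?case by (simp add: \<phi>_def)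
  qed
  have K': "((\<lambda>t. K t s) has_field_derivative \<phi> t s * K t s) (at t)" if "t \<in> B" for t s
    unfolding eq[OF that, symmetric] unfolding K_def
    using holomorphic_derivI[OF a B(1) that]
    by (auto intro!: derivative_eq_intros simp: mult.commute)
  have hol: "(deriv ^^ k) (a i) holomorphic_on B" if "i \<in> I" for k i
    using a[OF that] B(1) by (intro holomorphic_higher_deriv)
  define V where "V k s = (\<Sum>i\<in>I. (deriv ^^ k) (a i) t0 * b i s)" for k s
  \<comment> \<open>The \<open>k\<close>-th derivative of \<open>K\<close> is
    \<open>(\<phi>^k + E) K\<close> with \<open>E\<close> of lower degree: differentiating
    \<open>K\<close> contributes another factor \<open>\<phi>\<close>, while differentiating the
    bracket does not raise its degree.\<close>
  have rel: "\<exists>E. poly_family B L k E \<and>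
     (\<forall>t\<in>B. \<forall>s. (\<Sum>i\<in>I. (deriv ^^ k) (a i) t * b i s) = (\<phi> t s ^ k + E t s) * K t s)" for k
  proof (induction k)
    case 0
    then show ?case by (intro exI[of _ "\<lambda>t s. 0"]) (auto simp: K_def intro: poly_family.zero)
  next
    case (Suc k)
    then obtain E where E: "poly_family B L k E"
      "\<And>t s. t \<in> B \<Longrightarrow> (\<Sum>i\<in>I. (deriv ^^ k) (a i) t * b i s) = (\<phi> t s ^ k + E t s) * K t s"
      by blast
    obtain E' where E': "poly_family B L k E'"
      "\<And>t s. t \<in> B \<Longrightarrow> ((\<lambda>t. E t s) has_field_derivative E' t s) (at t)"
      using poly_family_deriv[OF B(1) E(1)] by blast
    obtain D where D: "poly_family B L (Suc k) D"
      "\<And>t s. t \<in> B \<Longrightarrow> ((\<lambda>t. \<phi> t s ^ k) has_field_derivative D t s) (at t)"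
      using poly_family_deriv[OF B(1) pow] by blast
    have \<phi>E: "poly_family B L (Suc k) (\<lambda>t s. \<phi> t s * E t s)"
      using poly_family_mult_sum[OF E(1) L order_refl \<psi>] by (simp add: \<phi>_def)
    have "poly_family B L (Suc k) (\<lambda>t s. D t s + (E' t s + \<phi> t s * E t s))"
      using D(1) E'(1) \<phi>E by (intro poly_family_add) (auto intro: poly_family_mono)
    moreover have "(\<Sum>i\<in>I. (deriv ^^ Suc k) (a i) t * b i s) =
        (\<phi> t s ^ Suc k + (D t s + (E' t s + \<phi> t s * E t s))) * K t s" if t: "t \<in> B" for t s
    proof -
      have d1: "((\<lambda>t. \<Sum>i\<in>I. (deriv ^^ k) (a i) t * b i s) has_field_derivative
          (\<Sum>i\<in>I. (deriv ^^ Suc k) (a i) t * b i s)) (at t)"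
        using holomorphic_derivI[OF hol B(1) t]
        by (auto intro!: derivative_eq_intros simp: mult.commute)
      have "((\<lambda>t. (\<phi> t s ^ k + E t s) * K t s) has_field_derivative
          (D t s + E' t s) * K t s + (\<phi> t s * K t s) * (\<phi> t s ^ k + E t s)) (at t)"
        by (intro DERIV_mult DERIV_add D E' K' t)
      then have "((\<lambda>t. \<Sum>i\<in>I. (deriv ^^ k) (a i) t * b i s) has_field_derivative
          (D t s + E' t s) * K t s + (\<phi> t s * K t s) * (\<phi> t s ^ k + E t s)) (at t)"
        by (rule has_field_derivative_transform_within_open[OF _ B(1) t]) (simp add: E(2))
      from DERIV_unique[OF d1 this] show ?thesis by (simp add: algebra_simps)
    qed
    ultimately show ?case by blast
  qed
  have "V k \<in> fs.span (b ` I)" for k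
  proof -
    have "V k = (\<Sum>i\<in>I. fscale ((deriv ^^ k) (a i) t0) (b i))"
      by (auto simp: V_def sum_fun_apply fscale_def)
    also have "\<dots> \<in> fs.span (b ` I)" by (intro fs.span_sum fs.span_scale fs.span_base imageI)
    finally show ?thesis .
  qed
  then obtain d where d: "V d \<in> fs.span (V ` {..<d})"
    using exists_in_span_of_previous[of "b ` I" V] I by auto
  \<comment> \<open>Each \<open>V k\<close> with \<open>k < d\<close> is \<open>K t0\<close> times a
    polynomial of degree at most \<open>k\<close>, and so lies below the bound
    \<open>d\<close>.\<close>
  have "\<exists>q\<in>poly_span L d. \<forall>s. v s = q s * K t0 s" if "v \<in> fs.span (V ` {..<d})" for v
    using that
  proof (induction rule: fs.span_induct_alt)
    case base
    then show ?case by (intro bexI[of _ 0]) (auto simp: poly_span_def fs.span_zero)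
  next
    case (step c u v)
    then obtain q k where q: "q \<in> poly_span L d" "\<forall>s. v s = q s * K t0 s"
      and k: "u = V k" "k < d" by auto
    obtain E where E: "poly_family B L k E" "\<And>s. V k s = (\<phi> t0 s ^ k + E t0 s) * K t0 s"
      using rel[of k] B(2) unfolding V_def by blast
    have "poly_family B L d (\<lambda>t s. \<phi> t s ^ k + E t s)"
      using pow[of k] E(1) k(2) by (intro poly_family_add) (auto intro: poly_family_mono)
    from poly_family_eval[OF this]
    have "fscale c (\<lambda>s. \<phi> t0 s ^ k + E t0 s) + q \<in> poly_span L d"
      using q(1) unfolding poly_span_def by (intro fs.span_add fs.span_scale)
    then show ?case
      by (rule bexI[rotated]) (use q k E in \<open>auto simp: fscale_def algebra_simps\<close>)
  qed
  from this[OF d] obtain q where q: "q \<in> poly_span L d" "\<And>s. V d s = q s * K t0 s" by blast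
  obtain E where E: "poly_family B L d E" "\<And>s. V d s = (\<phi> t0 s ^ d + E t0 s) * K t0 s"
    using rel[of d] B(2) unfolding V_def by blast
  have "\<phi> t0 s ^ d + E t0 s = q s" for s
    using q(2)[of s] E(2)[of s] nz[OF B(2), of s] by simp
  then have "(\<lambda>s. \<phi> t0 s ^ d) = q - E t0" by (auto simp: fun_eq_iff algebra_simps)
  also have "\<dots> \<in> poly_span L d"
    using q(1) poly_family_eval[OF E(1), of t0] unfolding poly_span_def by (intro fs.span_diff)
  finally show ?thesis by blast
qed

lemma finite_range_in_span:
  assumes "v \<in> fs.span L" "\<And>l. l \<in> L \<Longrightarrow> finite (range l)"
  shows "finite (range v)"
  using assms(1)
proof (induction rule: fs.span_induct_alt)
  case base
  then show ?case by (simp add: zero_fun_def)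
next
  case (step c x y)
  have "range (fscale c x + y) \<subseteq> (\<lambda>(u, v). c * u + v) ` (range x \<times> range y)"
    by (auto simp: fscale_def)
  then show ?case using step assms(2) by (meson finite_SigmaI finite_imageI finite_subset)
qed

text \<open>The power relations concern the functions \<open>\<phi> t\<close>, not the single terms
  \<open>q j\<close>. With \<open>L\<close> a basis chosen among the \<open>\<phi> t\<close>, every
  generator satisfies a relation, as \<open>finite_range_if_powers_reduce\<close> requires.\<close>

lemma log_derivative_finite_range:
  fixes a :: "'i \<Rightarrow> complex \<Rightarrow> complex" and b :: "'i \<Rightarrow> 'w \<Rightarrow> complex"
    and p :: "'j \<Rightarrow> complex \<Rightarrow> complex" and q :: "'j \<Rightarrow> 'w \<Rightarrow> complex" and I :: "'i set" and J :: "'j set"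
  defines "\<phi> \<equiv> \<lambda>t s. \<Sum>j\<in>J. p j t * q j s" and "K \<equiv> \<lambda>t s. \<Sum>i\<in>I. a i t * b i s"
  assumes B: "open B" "t0 \<in> B" and J: "finite J" and I: "finite I"
    and p: "\<And>j. j \<in> J \<Longrightarrow> p j holomorphic_on B"
    and a: "\<And>i. i \<in> I \<Longrightarrow> a i holomorphic_on B"
    and nz: "\<And>t s. t \<in> B \<Longrightarrow> K t s \<noteq> 0"
    and eq: "\<And>t s. t \<in> B \<Longrightarrow> (\<Sum>i\<in>I. deriv (a i) t * b i s) = \<phi> t s * K t s"
  shows "finite (range (\<phi> t0))"
proof -
  obtain L where L: "L \<subseteq> \<phi> ` B" "fs.independent L" "\<phi> ` B \<subseteq> fs.span L"
    using fs.maximal_independent_subset[of "\<phi> ` B"] by blast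
  have \<phi>_eq: "\<phi> t = (\<Sum>j\<in>J. fscale (p j t) (q j))" for t
    by (auto simp: \<phi>_def sum_fun_apply fscale_def)
  have "\<phi> t \<in> fs.span (q ` J)" for t
    unfolding \<phi>_eq by (intro fs.span_sum fs.span_scale fs.span_base imageI)
  then have finL: "finite L"
    using fs.independent_span_bound[of "q ` J" L] L J by blast
  \<comment> \<open>The \<open>q j\<close> may lie outside the span of \<open>L\<close>. Coordinates
    in a basis \<open>X\<close> of the whole space are linear on all functions, so the coordinate
    \<open>\<psi> l\<close> of \<open>\<phi> t\<close> is a combination of the \<open>p j\<close>,
    hence holomorphic.\<close>
  define X where "X = fs.extend_basis L"
  have X: "L \<subseteq> X" "fs.independent X" "\<And>v. v \<in> fs.span X"
    using fs.extend_basis_superset[OF L(2)] fs.independent_extend_basis[OF L(2)]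
      fs.span_extend_basis[OF L(2)] by (auto simp: X_def)
  define \<psi> where "\<psi> l t = (\<Sum>j\<in>J. p j t * fs.representation X (q j) l)" for l t
  have repr: "\<phi> t s = (\<Sum>l\<in>L. \<psi> l t * l s)" if "t \<in> B" for t s
  proof -
    have sp: "\<phi> t \<in> fs.span L" using L(3) that by blast
    have "fs.representation X (\<phi> t) l = \<psi> l t" for l
      unfolding \<phi>_eq \<psi>_def by (simp add: fs.representation_sum fs.representation_scale X)
    moreover have "fs.representation X (\<phi> t) = fs.representation L (\<phi> t)"
      using fs.representation_extend[OF X(2) sp X(1)] .
    ultimately have "(\<Sum>l\<in>L. fscale (\<psi> l t) l) = \<phi> t"
      using fs.sum_representation_eq[OF L(2) sp finL order_refl] by simp
    then show ?thesis by (metis (no_types, lifting) sum.cong sum_fun_apply fscale_def)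
  qed
  have "\<exists>d. (\<lambda>s. (\<Sum>l\<in>L. \<psi> l t * l s) ^ d) \<in> poly_span L d" if "t \<in> B" for t
  proof (rule log_derivative_power_reduces[where a = a and b = b and I = I and B = B])
    show "\<psi> l holomorphic_on B" for l
      unfolding \<psi>_def using p by (intro holomorphic_intros) auto
    show "(\<Sum>i\<in>I. deriv (a i) t * b i s) = (\<Sum>l\<in>L. \<psi> l t * l s) * (\<Sum>i\<in>I. a i t * b i s)"
      if "t \<in> B" for t s using eq[OF that, of s] repr[OF that] by (simp add: K_def)
  qed (use B finL I a nz that in \<open>auto simp: K_def\<close>)
  then have red: "\<exists>d. (\<lambda>s. \<phi> t s ^ d) \<in> poly_span L d" if "t \<in> B" for t
    using repr[OF that] that by simp
  then have "\<forall>l\<in>L. \<exists>d. (\<lambda>s. l s ^ d) \<in> poly_span L d" using L(1) by blast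
  then obtain d where d: "\<And>l. l \<in> L \<Longrightarrow> (\<lambda>s. l s ^ d l) \<in> poly_span L (d l)" by metis
  \<comment> \<open>Multiplying the relation for \<open>l ^ d l\<close> by the spare power of
    \<open>l\<close> gives one common exponent.\<close>
  define D where "D = (\<Sum>l\<in>L. d l)"
  have "(\<lambda>s. l s ^ D) \<in> poly_span L D" if l: "l \<in> L" for l
  proof -
    have le: "d l \<le> D" unfolding D_def using finL l by (intro member_le_sum) auto
    have "(\<lambda>s. l s ^ d l * monomial (replicate (D - d l) l) s) \<in> poly_span L (d l + (D - d l))"
      by (rule poly_span_mult_monomial[OF d[OF l], of "replicate (D - d l) l", simplified length_replicate])
        (use l in \<open>auto simp: in_set_replicate\<close>)
    then show ?thesis using le by (simp flip: power_add)
  qed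
  then have "finite (range l)" if "l \<in> L" for l
    using finite_range_if_powers_reduce[OF finL] that by blast
  then show ?thesis using finite_range_in_span L(3) B(2) by blast
qed

section \<open>Polarisation\<close>

text \<open>Finite sums of products of a holomorphic function of \<open>t\<close> and an
  antiholomorphic one of \<open>s\<close>.\<close>

inductive sesquiholomorphic :: "complex set \<Rightarrow> (complex \<Rightarrow> complex \<Rightarrow> complex) \<Rightarrow> bool"
  for B where
  zero: "sesquiholomorphic B (\<lambda>t s. 0)"
| step: "p holomorphic_on B \<Longrightarrow> q holomorphic_on B \<Longrightarrow> sesquiholomorphic B E \<Longrightarrow>
    sesquiholomorphic B (\<lambda>t s. p t * cnj (q s) + E t s)"

lemma sesquiholomorphic_add:
  "sesquiholomorphic B E \<Longrightarrow> sesquiholomorphic B E' \<Longrightarrow> sesquiholomorphic B (\<lambda>t s. E t s + E' t s)"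
  by (induction rule: sesquiholomorphic.induct) (auto simp: add.assoc intro: sesquiholomorphic.intros)

lemma sesquiholomorphic_mult_term:
  assumes "sesquiholomorphic B E" "p holomorphic_on B" "q holomorphic_on B"
  shows "sesquiholomorphic B (\<lambda>t s. p t * cnj (q s) * E t s)"
  using assms(1)
proof (induction rule: sesquiholomorphic.induct)
  case (step p' q' E)
  have "sesquiholomorphic B (\<lambda>t s. (p t * p' t) * cnj (q s * q' s) + p t * cnj (q s) * E t s)"
    using step assms(2,3) by (intro sesquiholomorphic.step holomorphic_intros) auto
  then show ?case by (simp add: algebra_simps)
qed (simp add: sesquiholomorphic.zero)

lemma sesquiholomorphic_mult:
  assumes "sesquiholomorphic B E" "sesquiholomorphic B E'"
  shows "sesquiholomorphic B (\<lambda>t s. E t s * E' t s)"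
  using assms(1)
proof (induction rule: sesquiholomorphic.induct)
  case (step p q E)
  then have "sesquiholomorphic B (\<lambda>t s. p t * cnj (q s) * E' t s + E t s * E' t s)"
    by (intro sesquiholomorphic_add sesquiholomorphic_mult_term assms)
  then show ?case by (simp add: algebra_simps)
qed (simp add: sesquiholomorphic.zero)

lemma sesquiholomorphic_const_mult:
  assumes "sesquiholomorphic B E"
  shows "sesquiholomorphic B (\<lambda>t s. c * E t s)"
  using sesquiholomorphic_mult_term[OF assms, of "\<lambda>_. c" "\<lambda>_. 1"] by simp

lemma sesquiholomorphic_sum:
  assumes "\<And>i. i \<in> I \<Longrightarrow> p i holomorphic_on B" "\<And>i. i \<in> I \<Longrightarrow> q i holomorphic_on B"
  shows "sesquiholomorphic B (\<lambda>t s. \<Sum>i\<in>I. c i * p i t * cnj (q i s))"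
  using assms
proof (induction I rule: infinite_finite_induct)
  case (insert i I)
  then show ?case
    by (auto intro!: sesquiholomorphic.step[where p = "\<lambda>t. c i * p i t" and q = "q i"] holomorphic_intros)
qed (simp_all add: sesquiholomorphic.zero)

text \<open>\<open>E1\<close> and \<open>E2\<close> are the derivatives in \<open>t\<close> and in
  \<open>cnj s\<close>; on the diagonal they give the complex-linear and the antilinear part of the
  real derivative.\<close>

lemma sesquiholomorphic_deriv:
  assumes "open B" "sesquiholomorphic B E"
  shows "\<exists>E1 E2. sesquiholomorphic B E1 \<and>
    (\<forall>t\<in>B. \<forall>s. ((\<lambda>t. E t s) has_field_derivative E1 t s) (at t)) \<and>
    (\<forall>t\<in>B. ((\<lambda>t. E t t) has_derivative (\<lambda>h. E1 t t * h + E2 t t * cnj h)) (at t))"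
  using assms(2)
proof (induction rule: sesquiholomorphic.induct)
  case zero
  show ?case
    by (intro exI[of _ "\<lambda>t s. 0"]) (auto intro: sesquiholomorphic.zero)
next
  case (step p q E)
  then obtain E1 E2 where E: "sesquiholomorphic B E1"
    "\<And>t s. t \<in> B \<Longrightarrow> ((\<lambda>t. E t s) has_field_derivative E1 t s) (at t)"
    "\<And>t. t \<in> B \<Longrightarrow> ((\<lambda>t. E t t) has_derivative (\<lambda>h. E1 t t * h + E2 t t * cnj h)) (at t)"
    by blast
  have "sesquiholomorphic B (\<lambda>t s. deriv p t * cnj (q s) + E1 t s)"
    using step E assms(1) by (intro sesquiholomorphic.step holomorphic_deriv)
  moreover have "((\<lambda>t. p t * cnj (q s) + E t s) has_field_derivative
      deriv p t * cnj (q s) + E1 t s) (at t)" if "t \<in> B" for t s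
    using E(2)[OF that] holomorphic_derivI[OF step(1) assms(1) that]
    by (auto intro!: derivative_eq_intros)
  moreover have "((\<lambda>t. p t * cnj (q t) + E t t) has_derivative
      (\<lambda>h. (deriv p t * cnj (q t) + E1 t t) * h + (p t * cnj (deriv q t) + E2 t t) * cnj h)) (at t)"
    if "t \<in> B" for t
  proof -
    have p: "(p has_derivative (\<lambda>h. deriv p t * h)) (at t)"
      using holomorphic_derivI[OF step(1) assms(1) that] by (rule has_field_derivative_imp_has_derivative)
    have q: "(q has_derivative (\<lambda>h. deriv q t * h)) (at t)"
      using holomorphic_derivI[OF step(2) assms(1) that] by (rule has_field_derivative_imp_has_derivative)
    have cq: "((\<lambda>t. cnj (q t)) has_derivative (\<lambda>h. cnj (deriv q t * h))) (at t)"
      by (rule bounded_linear.has_derivative[OF bounded_linear_cnj q])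
    show ?thesis
      by (rule derivative_eq_intros p cq E(3)[OF that] refl)+ (auto simp: algebra_simps)
  qed
  ultimately show ?case
    by (intro exI[of _ "\<lambda>t s. deriv p t * cnj (q s) + E1 t s"]
      exI[of _ "\<lambda>t s. p t * cnj (deriv q s) + E2 t s"]) blast
qed

text \<open>If \<open>E\<close> vanishes on the diagonal, so does the derivative of its diagonal
  restriction, and with it the complex-linear part \<open>E1\<close>. The argument repeats with
  \<open>E1\<close> in place of \<open>E\<close>.\<close>

lemma sesquiholomorphic_deriv_diagonal:
  assumes B: "open B" and "sesquiholomorphic B E" and "\<And>t. t \<in> B \<Longrightarrow> E t t = 0" and t: "t \<in> B"
  shows "(deriv ^^ n) (\<lambda>x. E x t) t = 0"
  using assms(2,3)
proof (induction n arbitrary: E)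
  case 0
  then show ?case using t by simp
next
  case (Suc n)
  obtain E1 E2 where E: "sesquiholomorphic B E1"
    "\<And>t s. t \<in> B \<Longrightarrow> ((\<lambda>t. E t s) has_field_derivative E1 t s) (at t)"
    "\<And>t. t \<in> B \<Longrightarrow> ((\<lambda>t. E t t) has_derivative (\<lambda>h. E1 t t * h + E2 t t * cnj h)) (at t)"
    using sesquiholomorphic_deriv[OF B Suc.prems(1)] by blast
  have diag: "E1 x x = 0" if "x \<in> B" for x
  proof -
    have "((\<lambda>t. E t t) has_derivative (\<lambda>h. 0)) (at x)"
      using has_derivative_const[of 0 "at x"]
      by (rule has_derivative_transform_within_open[OF _ B that]) (simp add: Suc.prems(2))
    from has_derivative_unique[OF E(3)[OF that] this]
    have *: "E1 x x * h + E2 x x * cnj h = 0" for h by (metis)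
    \<comment> \<open>The directions \<open>1\<close> and \<open>\<i>\<close> separate the linear
      from the antilinear part.\<close>
    show ?thesis using *[of 1] *[of \<i>] by (auto simp: algebra_simps complex_eq_iff)
  qed
  have "eventually (\<lambda>x. deriv (\<lambda>x. E x t) x = E1 x t) (nhds t)"
    unfolding eventually_nhds using B t E(2) DERIV_imp_deriv by blast
  from higher_deriv_cong_ev[OF this refl, of n]
  have "(deriv ^^ Suc n) (\<lambda>x. E x t) t = (deriv ^^ n) (\<lambda>x. E1 x t) t"
    by (simp add: funpow_swap1)
  then show ?case using Suc.IH[OF E(1) diag] by simp
qed

text \<open>For fixed \<open>s\<close> all derivatives of \<open>E(\<cdot>, s)\<close> vanish at the
  point \<open>s\<close>; the identity theorem on the connected set \<open>B\<close> does the
  rest.\<close>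

lemma sesquiholomorphic_eq_0:
  assumes B: "open B" "connected B" and E: "sesquiholomorphic B E" "\<And>t. t \<in> B \<Longrightarrow> E t t = 0"
    and t: "t \<in> B" "s \<in> B"
  shows "E t s = 0"
proof -
  have "(\<lambda>x. E x s) holomorphic_on B"
    using sesquiholomorphic_deriv[OF B(1) E(1)] B(1)
    by (metis (no_types, lifting) holomorphic_on_open)
  then show ?thesis
    using holomorphic_fun_eq_0_on_connected[OF _ B] sesquiholomorphic_deriv_diagonal[OF B(1) E t(2)] t
    by blast
qed

section \<open>Equal metrics along a complex line\<close>

text \<open>The hypothesis \<open>eq\<close> says that \<open>b\<close> times the flat metric is the
  Levi form of \<open>log K\<close>, multiplied through by the square of \<open>K\<close> on the
  diagonal.\<close>

lemma null_line_if_equal_metrics: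
  fixes f :: "'j \<Rightarrow> complex \<Rightarrow> complex" and \<epsilon> :: "'j \<Rightarrow> real"
    and g :: "'i \<Rightarrow> complex \<Rightarrow> complex" and \<eta> :: "'i \<Rightarrow> real" and b :: real
    and I :: "'i set" and J :: "'j set"
  assumes r: "r > 0" and b: "b \<noteq> 0" and fin: "finite I" "finite J"
    and f: "\<And>j. j \<in> J \<Longrightarrow> f j holomorphic_on ball 0 r"
    and g: "\<And>i. i \<in> I \<Longrightarrow> g i holomorphic_on ball 0 r"
    and nz: "(\<Sum>i\<in>I. \<eta> i * g i 0 * cnj (g i 0)) \<noteq> 0"
    and eq: "\<And>t. t \<in> ball 0 r \<Longrightarrow>
      b * (\<Sum>j\<in>J. \<epsilon> j * deriv (f j) t * cnj (deriv (f j) t)) * (\<Sum>i\<in>I. \<eta> i * g i t * cnj (g i t))\<^sup>2 =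
      (\<Sum>i\<in>I. \<eta> i * deriv (g i) t * cnj (deriv (g i) t)) * (\<Sum>i\<in>I. \<eta> i * g i t * cnj (g i t)) -
      (\<Sum>i\<in>I. \<eta> i * deriv (g i) t * cnj (g i t)) * (\<Sum>i\<in>I. \<eta> i * g i t * cnj (deriv (g i) t))"
  shows "(\<Sum>j\<in>J. \<epsilon> j * deriv (f j) 0 * cnj (deriv (f j) 0)) = 0"
proof -
  let ?B = "ball (0::complex) r"
  note f' = holomorphic_deriv[OF f open_ball] and g' = holomorphic_deriv[OF g open_ball]
  \<comment> \<open>The two digits in the names count derivatives in \<open>t\<close> and in
    \<open>cnj s\<close>; \<open>P\<close> is a primitive of \<open>A\<close> in
    \<open>cnj s\<close>.\<close>
  define K where "K t s = (\<Sum>i\<in>I. \<eta> i * g i t * cnj (g i s))" for t s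
  define K01 where "K01 t s = (\<Sum>i\<in>I. \<eta> i * g i t * cnj (deriv (g i) s))" for t s
  define K10 where "K10 t s = (\<Sum>i\<in>I. \<eta> i * deriv (g i) t * cnj (g i s))" for t s
  define K11 where "K11 t s = (\<Sum>i\<in>I. \<eta> i * deriv (g i) t * cnj (deriv (g i) s))" for t s
  define A where "A t s = (\<Sum>j\<in>J. \<epsilon> j * deriv (f j) t * cnj (deriv (f j) s))" for t s
  define P where "P t s = (\<Sum>j\<in>J. \<epsilon> j * deriv (f j) t * cnj (f j s))" for t s
  note defs = K_def K01_def K10_def K11_def A_def P_def
  have sK: "sesquiholomorphic ?B K" "sesquiholomorphic ?B K01" "sesquiholomorphic ?B K10"
      "sesquiholomorphic ?B K11" "sesquiholomorphic ?B A"
    unfolding defs by (intro sesquiholomorphic_sum f g f' g'; assumption)+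
  have polarised: "b * A t s * (K t s)\<^sup>2 = K11 t s * K t s - K10 t s * K01 t s"
    if "t \<in> ?B" "s \<in> ?B" for t s
  proof -
    have "sesquiholomorphic ?B (\<lambda>t s. b * (A t s * (K t s * K t s)) +
        ((-1) * (K11 t s * K t s) + K10 t s * K01 t s))"
      by (intro sesquiholomorphic_add sesquiholomorphic_mult sesquiholomorphic_const_mult sK)
    from sesquiholomorphic_eq_0[OF open_ball _ this _ that]
    have "b * (A t s * (K t s * K t s)) + ((-1) * (K11 t s * K t s) + K10 t s * K01 t s) = 0"
      using eq by (simp add: defs power2_eq_square mult.assoc)
    then show ?thesis by (simp add: power2_eq_square algebra_simps)
  qed
  \<comment> \<open>\<open>K\<close> is known to be nonzero at \<open>(0, 0)\<close>; continuity
    yields a smaller disc \<open>B\<close> with no zeros on \<open>B \<times> B\<close>, off the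
    diagonal too.\<close>
  have "continuous_on (?B \<times> ?B) (\<lambda>x. K (fst x) (snd x))"
    unfolding K_def
    by (intro continuous_intros continuous_on_compose2[OF holomorphic_on_imp_continuous_on[OF g]]) auto
  then have "open ((?B \<times> ?B) \<inter> (\<lambda>x. K (fst x) (snd x)) -` (- {0}))"
    by (intro continuous_open_preimage open_Times) auto
  moreover have "(0, 0) \<in> (?B \<times> ?B) \<inter> (\<lambda>x. K (fst x) (snd x)) -` (- {0})"
    using nz r by (simp add: K_def)
  ultimately obtain U V where UV: "open U" "open V" "(0, 0) \<in> U \<times> V"
    "U \<times> V \<subseteq> (?B \<times> ?B) \<inter> (\<lambda>x. K (fst x) (snd x)) -` (- {0})"
    by (rule open_prod_elim)
  then obtain d where d0: "d > 0" "ball 0 d \<subseteq> U \<inter> V" using openE[of "U \<inter> V" 0] by auto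
  then have d: "K t s \<noteq> 0" if "t \<in> ball 0 d" "s \<in> ball 0 d" for t s
    using UV(4) that by fastforce
  define B where "B = ball (0::complex) (min d r)"
  have B: "open B" "connected B" "convex B" "0 \<in> B" "B \<subseteq> ?B"
    and KB: "\<And>t s. t \<in> B \<Longrightarrow> s \<in> B \<Longrightarrow> K t s \<noteq> 0"
    using d0(1) d r by (auto simp: B_def)
  \<comment> \<open>By \<open>polarised\<close>, \<open>K10 / K\<close> and \<open>b P\<close> have
    the same derivative in \<open>cnj s\<close>, so they differ by a function of \<open>t\<close>
    alone, read off at \<open>s = 0\<close>.\<close>
  define \<gamma> where "\<gamma> t = K10 t 0 / K t 0 - b * P t 0" for t
  have log_deriv: "K10 t s = (b * P t s + \<gamma> t) * K t s" if t: "t \<in> B" and s: "s \<in> B" for t s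
  proof -
    \<comment> \<open>Conjugation turns the difference into a holomorphic function of
      \<open>s\<close>, so a zero complex derivative on the convex set \<open>B\<close> makes it
      constant.\<close>
    have "((\<lambda>s. cnj (K10 t s / K t s - b * P t s)) has_field_derivative 0) (at s within B)"
      if s: "s \<in> B" for s
    proof -
      have fd: "(f j has_field_derivative deriv (f j) s) (at s)" if "j \<in> J" for j
        using holomorphic_derivI[OF f[OF that] open_ball] s B(5) by blast
      have gd: "(g i has_field_derivative deriv (g i) s) (at s)" if "i \<in> I" for i
        using holomorphic_derivI[OF g[OF that] open_ball] s B(5) by blast
      have 1: "((\<lambda>s. cnj (K t s)) has_field_derivative cnj (K01 t s)) (at s)"
        unfolding defs by (auto intro!: derivative_eq_intros gd sum.cong)
      have 2: "((\<lambda>s. cnj (K10 t s)) has_field_derivative cnj (K11 t s)) (at s)"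
        unfolding defs by (auto intro!: derivative_eq_intros gd sum.cong)
      have 3: "((\<lambda>s. cnj (P t s)) has_field_derivative cnj (A t s)) (at s)"
        unfolding defs by (auto intro!: derivative_eq_intros fd sum.cong)
      have "((\<lambda>s. cnj (K10 t s) / cnj (K t s) - b * cnj (P t s)) has_field_derivative
        (cnj (K11 t s) * cnj (K t s) - cnj (K10 t s) * cnj (K01 t s)) / (cnj (K t s) * cnj (K t s))
          - b * cnj (A t s)) (at s)"
        using KB[OF t s] by (intro DERIV_diff DERIV_divide DERIV_cmult 1 2 3) auto
      also have "(cnj (K11 t s) * cnj (K t s) - cnj (K10 t s) * cnj (K01 t s)) / (cnj (K t s) * cnj (K t s))
          = cnj ((K11 t s * K t s - K10 t s * K01 t s) / (K t s * K t s))" by simp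
      also have "(K11 t s * K t s - K10 t s * K01 t s) / (K t s * K t s) = b * A t s"
        using polarised[OF subsetD[OF B(5) t] subsetD[OF B(5) s], symmetric] KB[OF t s]
        by (simp add: power2_eq_square)
      finally show ?thesis by (simp add: has_field_derivative_at_within)
    qed
    from has_field_derivative_zero_constant[OF B(3) this]
    obtain c where "\<And>s. s \<in> B \<Longrightarrow> cnj (K10 t s / K t s - b * P t s) = c" by blast
    then have "K10 t s / K t s - b * P t s = K10 t 0 / K t 0 - b * P t 0"
      using B(4) s by (metis complex_cnj_cancel_iff)
    then have "K10 t s / K t s = b * P t s + \<gamma> t" by (simp add: \<gamma>_def algebra_simps)
    then show ?thesis using KB[OF t s] by (simp add: field_simps)
  qed
  have \<gamma>_hol: "\<gamma> holomorphic_on B"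
    unfolding \<gamma>_def defs
    using KB[OF _ B(4)] f g f' g' B(1,5)
    by (intro holomorphic_intros) (auto simp: K_def intro: holomorphic_on_subset)
  text \<open>Retracting onto \<open>B\<close> turns identities for \<open>s \<in> B\<close> into identities of functions on the whole type.\<close>
  define \<rho> where "\<rho> s = (if s \<in> B then s else 0)" for s
  have \<rho>: "\<rho> s \<in> B" for s using B(4) by (simp add: \<rho>_def)
  \<comment> \<open>The index \<open>None\<close> carries the summand \<open>\<gamma> t\<close>,
    paired with the constant function \<open>1\<close>.\<close>
  define p where "p = case_option \<gamma> (\<lambda>j t. b * \<epsilon> j * deriv (f j) t)"
  define q where "q = case_option (\<lambda>s. 1) (\<lambda>j s. cnj (f j (\<rho> s)))"
  let ?J = "insert None (Some ` J)"
  have pq: "(\<Sum>j\<in>?J. p j t * q j s) = b * P t (\<rho> s) + \<gamma> t" for t s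
    using fin(2) by (subst sum.insert)
      (auto simp: sum.reindex p_def q_def P_def sum_distrib_left mult.assoc)
  have ab: "(\<Sum>i\<in>I. g i t * (\<eta> i * cnj (g i (\<rho> s)))) = K t (\<rho> s)"
     "(\<Sum>i\<in>I. deriv (g i) t * (\<eta> i * cnj (g i (\<rho> s)))) = K10 t (\<rho> s)" for t s
    unfolding defs by (auto intro!: sum.cong)
  have "finite (range (\<lambda>s. \<Sum>j\<in>?J. p j 0 * q j s))"
  proof (rule log_derivative_finite_range[where B = B and I = I and a = g and b = "\<lambda>i s. \<eta> i * cnj (g i (\<rho> s))"])
    show "p j holomorphic_on B" if "j \<in> ?J" for j
      using that B(5)
      by (auto simp: p_def intro!: holomorphic_on_mult holomorphic_on_const holomorphic_on_subset[OF f'] holomorphic_on_subset[OF \<gamma>_hol])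
    show "g i holomorphic_on B" if "i \<in> I" for i using g[OF that] B(5) by (rule holomorphic_on_subset)
  qed (use B fin KB \<rho> in \<open>simp_all add: pq ab log_deriv\<close>)
  then have "finite (range (\<lambda>s. b * P 0 (\<rho> s) + \<gamma> 0))" unfolding pq .
  moreover have "(\<lambda>s. b * P 0 s + \<gamma> 0) ` B \<subseteq> range (\<lambda>s. b * P 0 (\<rho> s) + \<gamma> 0)"
    by (auto simp: \<rho>_def image_iff)
  ultimately have fr: "finite ((\<lambda>s. b * P 0 s + \<gamma> 0) ` B)" by (rule finite_subset[rotated])
  \<comment> \<open>A continuous function with finite range on a connected set is constant. Hence
    the derivative of \<open>P 0\<close> in \<open>cnj s\<close>, which at \<open>0\<close> is
    \<open>A 0 0\<close>, vanishes.\<close>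
  have "continuous_on B (\<lambda>s. b * P 0 s + \<gamma> 0)"
    unfolding defs using holomorphic_on_imp_continuous_on[OF f] B(5)
    by (intro continuous_intros) (auto intro: continuous_on_subset)
  then have "(\<lambda>s. b * P 0 s + \<gamma> 0) constant_on B"
    using continuous_finite_range_constant[OF B(2) _ fr] by blast
  then obtain c where "\<And>s. s \<in> B \<Longrightarrow> b * P 0 s + \<gamma> 0 = c" unfolding constant_on_def by blast
  then have c: "P 0 s = (c - \<gamma> 0) / b" if "s \<in> B" for s using that b by (simp add: field_simps)
  have "((\<lambda>s. cnj (P 0 s)) has_field_derivative 0) (at 0)"
    by (rule has_field_derivative_transform_within_open[OF _ B(1,4), of "\<lambda>_. cnj ((c - \<gamma> 0) / b)"])
      (auto simp: c)
  moreover have "((\<lambda>s. cnj (P 0 s)) has_field_derivative cnj (A 0 0)) (at 0)"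
  proof -
    have fd: "(f j has_field_derivative deriv (f j) 0) (at 0)" if "j \<in> J" for j
      using holomorphic_derivI[OF f[OF that] open_ball] r by simp
    show ?thesis unfolding defs by (auto intro!: derivative_eq_intros fd sum.cong)
  qed
  ultimately have "cnj (A 0 0) = 0" by (rule DERIV_unique[rotated])
  then have "A 0 0 = 0" by (simp only: complex_cnj_zero_iff)
  then show ?thesis by (simp only: A_def)
qed

section \<open>Hermitian potentials\<close>

definition sesquilinear :: "(complex^'n \<Rightarrow> complex^'n \<Rightarrow> complex) \<Rightarrow> bool"
  where "sesquilinear T \<longleftrightarrow>
    (\<forall>u u' v. T (u + u') v = T u v + T u' v) \<and> (\<forall>u v v'. T u (v + v') = T u v + T u v') \<and>
    (\<forall>c u v. T (c *s u) v = c * T u v) \<and> (\<forall>c u v. T u (c *s v) = cnj c * T u v)"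

lemma sesquilinear_sum:
  assumes T: "sesquilinear T"
  shows "T (\<Sum>j\<in>J. c j *s x j) v = (\<Sum>j\<in>J. c j * T (x j) v)"
    and "T u (\<Sum>j\<in>J. c j *s x j) = (\<Sum>j\<in>J. cnj (c j) * T u (x j))"
proof -
  have "T (0 *s 0) v = 0" "T u (0 *s 0) = 0"
    using T unfolding sesquilinear_def by (metis mult_zero_left complex_cnj_zero)+
  then have "T 0 v = 0" "T u 0 = 0" by simp_all
  then show "T (\<Sum>j\<in>J. c j *s x j) v = (\<Sum>j\<in>J. c j * T (x j) v)"
    and "T u (\<Sum>j\<in>J. c j *s x j) = (\<Sum>j\<in>J. cnj (c j) * T u (x j))"
    using T unfolding sesquilinear_def
    by (induction J rule: infinite_finite_induct) simp_all
qed

lemma sesquilinear_expand: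
  assumes T: "sesquilinear T"
  shows "T u v = (\<Sum>j\<in>UNIV. \<Sum>k\<in>UNIV. T (axis j 1) (axis k 1) * (u $ j * cnj (v $ k)))"
proof -
  have "T u v = T (\<Sum>j\<in>UNIV. u $ j *s axis j 1) (\<Sum>k\<in>UNIV. v $ k *s axis k 1)"
    by (simp add: basis_expansion)
  also have "\<dots> = (\<Sum>j\<in>UNIV. \<Sum>k\<in>UNIV. T (axis j 1) (axis k 1) * (u $ j * cnj (v $ k)))"
    unfolding sesquilinear_sum(1)[OF T] sesquilinear_sum(2)[OF T]
    by (simp add: sum_distrib_left mult_ac) (rule sum.swap)
  finally show ?thesis .
qed

text \<open>Complex polarisation: the vectors \<open>u + v\<close> and \<open>\<i> *s u + v\<close>
  isolate the sum and the difference of \<open>T u v\<close> and \<open>T v u\<close>.\<close>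

lemma sesquilinear_eq_0:
  assumes T: "sesquilinear T" and "\<And>e. T e e = 0"
  shows "T u v = 0"
proof -
  have "T (u + v) (u + v) = T u u + T u v + T v u + T v v"
    "T (\<i> *s u + v) (\<i> *s u + v) = T u u + \<i> * T u v - \<i> * T v u + T v v"
    using T unfolding sesquilinear_def by (simp_all add: algebra_simps)
  then have "T u v + T v u = 0" "\<i> * (T u v - T v u) = 0"
    using assms(2) by (simp_all add: right_diff_distrib)
  then show ?thesis by simp
qed

lemma sesquilinear_diff_divide:
  assumes "sesquilinear S" "sesquilinear T"
  shows "sesquilinear (\<lambda>u v. S u v / a - T u v / b)"
  using assms unfolding sesquilinear_def
  by (simp add: add_divide_distrib right_diff_distrib)

lemma i_ddbar_sesquilinear:
  assumes "sesquilinear T" "\<And>j k. wirtinger j (wirtinger_bar k f) z = T (axis j 1) (axis k 1)"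
  shows "i_ddbar f z u v = \<i> * (T u v - T v u)"
  unfolding i_ddbar_def assms(2) sesquilinear_expand[OF assms(1), of u v] sesquilinear_expand[OF assms(1), of v u]
  by (simp add: right_diff_distrib sum_subtractf)

text \<open>The pair \<open>u\<close>, \<open>\<i> *s u\<close> recovers the Levi form
  \<open>T u u\<close> from the two-form, because \<open>T u (\<i> *s u)\<close> and
  \<open>T (\<i> *s u) u\<close> are opposite.\<close>

lemma i_ddbar_diagonal:
  assumes T: "sesquilinear T" "\<And>j k. wirtinger j (wirtinger_bar k f) z = T (axis j 1) (axis k 1)"
  shows "i_ddbar f z u (\<i> *s u) = 2 * T u u"
  using T(1) unfolding i_ddbar_sesquilinear[OF T] sesquilinear_def by simp

text \<open>The Wirtinger operators select the complex-linear and the antilinear part of a real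
  derivative, so exhibiting the splitting is enough to compute them.\<close>

lemma wirtinger_split:
  assumes "(f has_derivative (\<lambda>h. \<alpha> h + \<beta> h)) (at z)"
    and "\<alpha> (\<i> *s axis j 1) = \<i> * \<alpha> (axis j 1)" "\<beta> (\<i> *s axis j 1) = - \<i> * \<beta> (axis j 1)"
  shows "wirtinger j f z = \<alpha> (axis j 1)" "wirtinger_bar j f z = \<beta> (axis j 1)"
proof -
  have ax: "axis j \<i> = \<i> *s axis j 1" by (simp add: axis_def vec_eq_iff)
  have fd: "frechet_derivative f (at z) = (\<lambda>h. \<alpha> h + \<beta> h)"
    using frechet_derivative_at[OF assms(1)] by simp
  show "wirtinger j f z = \<alpha> (axis j 1)" "wirtinger_bar j f z = \<beta> (axis j 1)"
    unfolding wirtinger_def wirtinger_bar_def fd ax assms(2,3) by (simp_all add: algebra_simps)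
qed

section \<open>Hermitian forms composed with affine maps\<close>

definition herm :: "('x \<Rightarrow> real) \<Rightarrow> complex^'x \<Rightarrow> complex^'x \<Rightarrow> complex"
  where "herm \<eta> u v = (\<Sum>x\<in>UNIV. of_real (\<eta> x) * u $ x * cnj (v $ x))"

lemma sesquilinear_herm: "sesquilinear (herm \<eta>)"
  unfolding sesquilinear_def herm_def
  by (auto simp: sum_distrib_left algebra_simps simp flip: sum.distrib)

lemma cnj_herm: "cnj (herm \<eta> u v) = herm \<eta> v u"
  by (simp add: herm_def mult_ac)

lemma herm_self: "herm \<eta> u u = of_real (\<Sum>x\<in>UNIV. \<eta> x * (cmod (u $ x))\<^sup>2)"
  unfolding herm_def by (simp add: mult.assoc complex_norm_square flip: of_real_power)

lemma herm_scale: "herm \<eta> (a *s u) v = a * herm \<eta> u v" "herm \<eta> u (a *s v) = cnj a * herm \<eta> u v"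
  using sesquilinear_herm[of \<eta>] unfolding sesquilinear_def by blast+

lemma of_real_Re_herm_self: "of_real (Re (herm \<eta> u u)) = herm \<eta> u u"
  by (simp add: herm_self)

lemma sesquilinear_herm_linear:
  assumes "\<And>u v. L (u + v) = L u + L v" "\<And>c u. L (c *s u) = c *s L u"
  shows "sesquilinear (\<lambda>u v. herm \<eta> (L u) (L v))"
    and "sesquilinear (\<lambda>u v. herm \<eta> (L u) a * herm \<eta> a (L v))"
  using sesquilinear_herm[of \<eta>] unfolding sesquilinear_def by (simp_all add: assms algebra_simps)

text \<open>The affine map \<open>c + L z\<close> is the identity in the flat case and
  \<open>affine_lift l\<close> in a projective chart.\<close>

context
  fixes \<eta> :: "'x::finite \<Rightarrow> real" and L :: "complex^'n::finite \<Rightarrow> complex^'x" and c :: "complex^'x"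
  assumes L_add: "\<And>u v. L (u + v) = L u + L v" and L_scale: "\<And>a u. L (a *s u) = a *s L u"
begin

lemma affine_nth_has_derivative: "((\<lambda>z. (c + L z) $ x) has_derivative (\<lambda>h. L h $ x)) (at z)"
proof -
  have "linear (\<lambda>z. L z $ x)"
  proof
    fix r :: real and u :: "complex^'n"
    have scale: "r *\<^sub>R u = of_real r *s u"
      by (simp add: vec_eq_iff) (simp add: scaleR_conv_of_real)
    show "L (r *\<^sub>R u) $ x = r *\<^sub>R L u $ x"
      unfolding scale L_scale vector_smult_component by (simp only: scaleR_conv_of_real)
  qed (simp add: L_add)
  then have "bounded_linear (\<lambda>z. L z $ x)" by (simp add: linear_conv_bounded_linear)
  then have "((\<lambda>z. L z $ x) has_derivative (\<lambda>h. L h $ x)) (at z)"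
    by (rule bounded_linear_imp_has_derivative)
  then show ?thesis by (auto intro!: derivative_eq_intros)
qed

lemma herm_left_has_derivative:
  "((\<lambda>z. herm \<eta> (c + L z) v) has_derivative (\<lambda>h. herm \<eta> (L h) v)) (at z)"
  unfolding herm_def
  by (rule derivative_eq_intros affine_nth_has_derivative refl)+ (simp add: algebra_simps)

lemma herm_self_has_derivative:
  "((\<lambda>z. herm \<eta> (c + L z) (c + L z)) has_derivative
    (\<lambda>h. herm \<eta> (L h) (c + L z) + herm \<eta> (c + L z) (L h))) (at z)"
  unfolding herm_def
  by (rule derivative_eq_intros affine_nth_has_derivative bounded_linear.has_derivative[OF bounded_linear_cnj] refl)+
    (simp add: algebra_simps sum.distrib)

lemma wirtinger_bar_herm_self:
  "wirtinger_bar k (\<lambda>z. herm \<eta> (c + L z) (c + L z)) z = herm \<eta> (c + L z) (L (axis k 1))"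
  by (rule wirtinger_split(2)[OF herm_self_has_derivative]) (simp_all add: L_scale herm_scale)

lemma wirtinger_wirtinger_bar_herm_self:
  "wirtinger j (wirtinger_bar k (\<lambda>z. herm \<eta> (c + L z) (c + L z))) z =
    herm \<eta> (L (axis j 1)) (L (axis k 1))"
proof -
  have "wirtinger_bar k (\<lambda>z. herm \<eta> (c + L z) (c + L z)) = (\<lambda>z. herm \<eta> (c + L z) (L (axis k 1)))"
    using wirtinger_bar_herm_self by blast
  moreover have "((\<lambda>z. herm \<eta> (c + L z) (L (axis k 1))) has_derivative
      (\<lambda>h. herm \<eta> (L h) (L (axis k 1)) + 0)) (at z)"
    using herm_left_has_derivative by simp
  from wirtinger_split(1)[OF this] have
    "wirtinger j (\<lambda>z. herm \<eta> (c + L z) (L (axis k 1))) z = herm \<eta> (L (axis j 1)) (L (axis k 1))"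
    by (simp add: L_scale herm_scale)
  ultimately show ?thesis by simp
qed

lemma i_ddbar_herm_self:
  "i_ddbar (\<lambda>z. herm \<eta> (c + L z) (c + L z)) z u v = \<i> * (herm \<eta> (L u) (L v) - herm \<eta> (L v) (L u))"
  "i_ddbar (\<lambda>z. herm \<eta> (c + L z) (c + L z)) z u (\<i> *s u) = 2 * herm \<eta> (L u) (L u)"
  using sesquilinear_herm_linear(1)[OF L_add L_scale, of \<eta>] wirtinger_wirtinger_bar_herm_self
  by (rule i_ddbar_sesquilinear i_ddbar_diagonal)+

lemma Re_herm_self_has_derivative:
  "((\<lambda>z. Re (herm \<eta> (c + L z) (c + L z))) has_derivative (\<lambda>h. Re (herm \<eta> (L h) (c + L z) + herm \<eta> (c + L z) (L h)))) (at z)"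
  by (rule bounded_linear.has_derivative[OF bounded_linear_Re herm_self_has_derivative])

lemma wirtinger_bar_ln_herm_self:
  assumes "Re (herm \<eta> (c + L z) (c + L z)) > 0"
  shows "wirtinger_bar k (\<lambda>z. of_real (ln (Re (herm \<eta> (c + L z) (c + L z))))) z =
    herm \<eta> (c + L z) (L (axis k 1)) / herm \<eta> (c + L z) (c + L z)"
proof -
  have re: "of_real (Re (herm \<eta> u v + herm \<eta> v u)) = herm \<eta> u v + herm \<eta> v u" for u v
    using cnj_herm[of \<eta> u v] by (metis complex_add_cnj Re_complex_of_real)
  have "((\<lambda>z. complex_of_real (ln (Re (herm \<eta> (c + L z) (c + L z))))) has_derivative
      (\<lambda>h. of_real (Re (herm \<eta> (L h) (c + L z) + herm \<eta> (c + L z) (L h)) / Re (herm \<eta> (c + L z) (c + L z))))) (at z)"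
    using assms by (intro has_derivative_of_real has_derivative_eq_rhs[OF has_derivative_ln[OF _ Re_herm_self_has_derivative]])
      (auto simp: divide_inverse)
  then have "((\<lambda>z. complex_of_real (ln (Re (herm \<eta> (c + L z) (c + L z))))) has_derivative
      (\<lambda>h. herm \<eta> (L h) (c + L z) / Re (herm \<eta> (c + L z) (c + L z)) + herm \<eta> (c + L z) (L h) / Re (herm \<eta> (c + L z) (c + L z)))) (at z)"
    unfolding of_real_divide re by (simp add: add_divide_distrib)
  from wirtinger_split(2)[OF this] show ?thesis by (simp add: L_scale herm_scale of_real_Re_herm_self)
qed

lemma wirtinger_wirtinger_bar_ln_herm_self:
  assumes z: "Re (herm \<eta> (c + L z) (c + L z)) > 0"
  shows "wirtinger j (wirtinger_bar k (\<lambda>z. of_real (ln (Re (herm \<eta> (c + L z) (c + L z)))))) z =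
    herm \<eta> (L (axis j 1)) (L (axis k 1)) / herm \<eta> (c + L z) (c + L z) -
    herm \<eta> (L (axis j 1)) (c + L z) * herm \<eta> (c + L z) (L (axis k 1)) / (herm \<eta> (c + L z) (c + L z))\<^sup>2"
proof -
  let ?Q = "herm \<eta> (c + L z) (c + L z)"
  have nz: "?Q \<noteq> 0" using z by auto
  \<comment> \<open>The formula for the first derivative holds where the form is positive. This set
    must be open for the formula to be differentiated again.\<close>
  have "continuous_on UNIV (\<lambda>z. Re (herm \<eta> (c + L z) (c + L z)))"
    using has_derivative_continuous[OF Re_herm_self_has_derivative] by (simp add: continuous_on_eq_continuous_at)
  then have op: "open {z. Re (herm \<eta> (c + L z) (c + L z)) > 0}" by (intro open_Collect_less) auto
  \<comment> \<open>The quotient rule is arranged as a complex-linear bracket in \<open>h\<close>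
    plus an antilinear term, ready for \<open>wirtinger_split\<close>.\<close>
  have "((\<lambda>y. herm \<eta> (c + L y) (L (axis k 1)) / herm \<eta> (c + L y) (c + L y)) has_derivative
      (\<lambda>h. (herm \<eta> (L h) (L (axis k 1)) / ?Q - herm \<eta> (L h) (c + L z) * herm \<eta> (c + L z) (L (axis k 1)) / ?Q\<^sup>2) +
         - (herm \<eta> (c + L z) (L h) * herm \<eta> (c + L z) (L (axis k 1)) / ?Q\<^sup>2))) (at z)"
    by (rule has_derivative_eq_rhs[OF has_derivative_divide'[OF herm_left_has_derivative herm_self_has_derivative nz]])
      (use nz in \<open>auto simp: field_simps power2_eq_square\<close>)
  then have "((wirtinger_bar k (\<lambda>z. of_real (ln (Re (herm \<eta> (c + L z) (c + L z)))))) has_derivative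
      (\<lambda>h. (herm \<eta> (L h) (L (axis k 1)) / ?Q - herm \<eta> (L h) (c + L z) * herm \<eta> (c + L z) (L (axis k 1)) / ?Q\<^sup>2) +
         - (herm \<eta> (c + L z) (L h) * herm \<eta> (c + L z) (L (axis k 1)) / ?Q\<^sup>2))) (at z)"
    by (rule has_derivative_transform_within_open[OF _ op]) (use z wirtinger_bar_ln_herm_self in auto)
  from wirtinger_split(1)[OF this] show ?thesis by (simp add: L_scale herm_scale algebra_simps)
qed

text \<open>The Fubini-Study expression; multiplied by the square of the form it takes the shape of
  the right-hand side in \<open>null_line_if_equal_metrics\<close>.\<close>

lemma i_ddbar_ln_herm_self:
  assumes z: "Re (herm \<eta> (c + L z) (c + L z)) > 0"
  shows "i_ddbar (\<lambda>z. of_real (ln (Re (herm \<eta> (c + L z) (c + L z))))) z u (\<i> *s u) = 2 *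
    (herm \<eta> (L u) (L u) / herm \<eta> (c + L z) (c + L z) -
     herm \<eta> (L u) (c + L z) * herm \<eta> (c + L z) (L u) / (herm \<eta> (c + L z) (c + L z))\<^sup>2)"
proof -
  let ?Q = "herm \<eta> (c + L z) (c + L z)"
  have "sesquilinear (\<lambda>u v. herm \<eta> (L u) (L v) / ?Q - herm \<eta> (L u) (c + L z) * herm \<eta> (c + L z) (L v) / ?Q\<^sup>2)"
    by (intro sesquilinear_diff_divide sesquilinear_herm_linear L_add L_scale)
  from i_ddbar_diagonal[OF this wirtinger_wirtinger_bar_ln_herm_self[OF z]] show ?thesis .
qed

end

section \<open>Restriction to complex lines\<close>

lemma holomorphic_map_on_line:
  assumes f: "holomorphic_map_on f S" and t: "z + t *s e \<in> S"
  shows "((\<lambda>t. f (z + t *s e) $ j) has_field_derivative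
    frechet_derivative f (at (z + t *s e)) e $ j) (at t)"
    and "frechet_derivative f (at (z + t *s e)) (\<i> *s u) = \<i> *s frechet_derivative f (at (z + t *s e)) u"
proof -
  let ?w = "z + t *s e" and ?f' = "frechet_derivative f (at (z + t *s e))"
  obtain f' where f': "(f has_derivative f') (at ?w)" "\<And>c v. f' (c *s v) = c *s f' v"
    using f t unfolding holomorphic_map_on_def by blast
  have fd: "?f' = f'" using frechet_derivative_at[OF f'(1)] by simp
  have "bounded_linear (\<lambda>h. h *s e)"
  proof -
    have "linear (\<lambda>h. h *s e)"
    proof
      fix r :: real and h :: complex
      show "(r *\<^sub>R h) *s e = r *\<^sub>R (h *s e)" by (simp add: vec_eq_iff)
    qed (simp add: vec_eq_iff distrib_right)
    then show ?thesis by (simp add: linear_conv_bounded_linear)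
  qed
  then have "((\<lambda>t. z + t *s e) has_derivative (\<lambda>h. h *s e)) (at t)"
    by (auto intro!: derivative_eq_intros bounded_linear_imp_has_derivative)
  from has_derivative_compose[OF this f'(1)]
  have "((\<lambda>t. f (z + t *s e)) has_derivative (\<lambda>h. h *s f' e)) (at t)" by (simp add: f'(2))
  from bounded_linear.has_derivative[OF bounded_linear_vec_nth this, of j]
  show "((\<lambda>t. f (z + t *s e) $ j) has_field_derivative ?f' e $ j) (at t)"
    unfolding fd by (simp add: has_field_derivative_def mult_commute_abs)
  show "?f' (\<i> *s u) = \<i> *s ?f' u" unfolding fd by (rule f'(2))
qed

section \<open>Potentials of the flat and projective spaces\<close>

text \<open>Sign weights merge the positive and negative sums of both model potentials into a single
  \<open>herm\<close>.\<close>

definition signature :: "('x \<Rightarrow> nat) \<Rightarrow> nat \<Rightarrow> 'x \<Rightarrow> real"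
  where "signature e k x = (if e x \<le> k then 1 else - 1)"

lemma signature_sum:
  fixes h :: "'x::finite \<Rightarrow> real"
  shows "(\<Sum>x | e x \<le> k. h x) - (\<Sum>x | e x > k. h x) = (\<Sum>x\<in>UNIV. signature e k x * h x)"
proof -
  have "(\<Sum>x\<in>UNIV. signature e k x * h x) = (\<Sum>x\<in>UNIV. if e x \<le> k then h x else - h x)"
    by (rule sum.cong) (auto simp: signature_def)
  also have "\<dots> = (\<Sum>x | e x \<le> k. h x) - (\<Sum>x | e x > k. h x)"
    by (simp add: sum.If_cases sum_negf Collect_neg_eq[symmetric] not_le)
  finally show ?thesis by simp
qed

abbreviation euclidean_signs :: "nat \<Rightarrow> 'n::finite \<Rightarrow> real" ("\<epsilon>E")
  where "\<epsilon>E s \<equiv> signature coord_num (CARD('n) - s)"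

abbreviation homogeneous_signs :: "nat \<Rightarrow> 'n::finite option \<Rightarrow> real" ("\<epsilon>P")
  where "\<epsilon>P s \<equiv> signature hcoord_num (CARD('n) - s)"

lemma euclidean_form_herm: "complex_of_real (euclidean_form s z) = herm (\<epsilon>E s) z z"
  unfolding euclidean_form_def signature_sum herm_self ..

lemma homogeneous_form_herm: "complex_of_real (homogeneous_form s \<xi>) = herm (\<epsilon>P s) \<xi> \<xi>"
  unfolding homogeneous_form_def signature_sum herm_self ..

lemma homogeneous_form_scale: "homogeneous_form s (c *s \<xi>) = (cmod c)\<^sup>2 * homogeneous_form s \<xi>"
  unfolding homogeneous_form_def
  by (simp add: norm_mult power_mult_distrib sum_distrib_left right_diff_distrib)

text \<open>The linear part of the affine map \<open>affine_lift l\<close>.\<close>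

definition affine_lift_deriv :: "'n::finite option \<Rightarrow> complex^'n \<Rightarrow> complex^('n option)"
  where "affine_lift_deriv l w = affine_lift l w - affine_lift l 0"

lemma affine_lift_split: "affine_lift l w = affine_lift l 0 + affine_lift_deriv l w"
  by (simp add: affine_lift_deriv_def)

lemma affine_lift_deriv_add: "affine_lift_deriv l (u + v) = affine_lift_deriv l u + affine_lift_deriv l v"
  by (simp add: affine_lift_deriv_def affine_lift_def vec_eq_iff split: option.split)

lemma affine_lift_deriv_scale: "affine_lift_deriv l (c *s u) = c *s affine_lift_deriv l u"
  by (simp add: affine_lift_deriv_def affine_lift_def vec_eq_iff split: option.split)

lemma i_ddbar_euclidean_form:
  "i_ddbar (\<lambda>z. of_real (euclidean_form s z)) z u v = \<i> * (herm (\<epsilon>E s) u v - herm (\<epsilon>E s) v u)"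
  "i_ddbar (\<lambda>z. of_real (euclidean_form s z)) z u (\<i> *s u) = 2 * herm (\<epsilon>E s) u u"
  using i_ddbar_herm_self[of "\<lambda>z. z" "\<epsilon>E s" 0] unfolding euclidean_form_herm by simp_all

lemma i_ddbar_ln_homogeneous_form:
  assumes "homogeneous_form s (affine_lift l w) > 0"
  shows "i_ddbar (\<lambda>w. of_real (ln (homogeneous_form s (affine_lift l w)))) w u (\<i> *s u) =
    2 * (herm (\<epsilon>P s) (affine_lift_deriv l u) (affine_lift_deriv l u) /
         herm (\<epsilon>P s) (affine_lift l w) (affine_lift l w) -
       herm (\<epsilon>P s) (affine_lift_deriv l u) (affine_lift l w) *
       herm (\<epsilon>P s) (affine_lift l w) (affine_lift_deriv l u) /
       (herm (\<epsilon>P s) (affine_lift l w) (affine_lift l w))\<^sup>2)"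
proof -
  have q: "homogeneous_form s (affine_lift l w) =
      Re (herm (\<epsilon>P s) (affine_lift l 0 + affine_lift_deriv l w) (affine_lift l 0 + affine_lift_deriv l w))"
    for w
    unfolding affine_lift_split[symmetric] homogeneous_form_herm[symmetric] by simp
  show ?thesis
    using i_ddbar_ln_herm_self[where L = "affine_lift_deriv l" and \<eta> = "\<epsilon>P s" and c = "affine_lift l 0"
        and z = w and u = u, OF affine_lift_deriv_add affine_lift_deriv_scale] assms
    unfolding q unfolding affine_lift_split[symmetric] by simp
qed

section \<open>Local comparison of the two metrics\<close>

text \<open>On the complex line through \<open>z\<close> in direction \<open>e\<close>, evaluating
  both pullbacks at \<open>e\<close> and \<open>\<i> *s e\<close> gives the identity of
  \<open>null_line_if_equal_metrics\<close>. So the flat Hermitian form vanishes on every image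
  vector, hence identically on the image, against non-degeneracy of \<open>\<omega>\<close>.\<close>

lemma local_pullbacks_differ:
  fixes f :: "complex^'d::finite \<Rightarrow> complex^'n::finite" and g :: "complex^'d \<Rightarrow> complex^'m::finite"
    and \<omega> :: "complex^'d \<Rightarrow> complex^'d \<Rightarrow> complex^'d \<Rightarrow> complex" and c :: real
  assumes S: "open S" "z \<in> S" and f: "holomorphic_map_on f S" and g: "holomorphic_map_on g S"
    and c: "c \<noteq> 0"
    and pos: "\<And>y. y \<in> S \<Longrightarrow> homogeneous_form \<sigma> (affine_lift l (g y)) > 0"
    and \<omega>f: "\<And>y u v. y \<in> S \<Longrightarrow> i_ddbar (\<lambda>z. of_real (euclidean_form s z)) (f y)
      (frechet_derivative f (at y) u) (frechet_derivative f (at y) v) = \<omega> y u v"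
    and \<omega>g: "\<And>y u v. y \<in> S \<Longrightarrow> of_real c *
      i_ddbar (\<lambda>w. of_real (ln (homogeneous_form \<sigma> (affine_lift l w)))) (g y)
      (frechet_derivative g (at y) u) (frechet_derivative g (at y) v) = \<omega> y u v"
    and nondeg: "\<And>u. (\<And>v. \<omega> z u v = 0) \<Longrightarrow> u = 0"
  shows False
proof -
  let ?f' = "\<lambda>y. frechet_derivative f (at y)" and ?g' = "\<lambda>y. frechet_derivative g (at y)"
  let ?dl = "affine_lift_deriv l :: complex^'m \<Rightarrow> complex^('m option)"
  have "herm (\<epsilon>E s) (?f' z e) (?f' z e) = 0" for e
  proof -
    define \<gamma> where "\<gamma> t = z + t *s e" for t
    have "continuous_on UNIV \<gamma>"
      unfolding \<gamma>_def vector_scalar_mult_def by (intro continuous_intros)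
    then have "open (\<gamma> -` S)" using S(1) open_vimage by blast
    moreover have "0 \<in> \<gamma> -` S" using S(2) by (simp add: \<gamma>_def)
    ultimately obtain r where r: "r > 0" "ball 0 r \<subseteq> \<gamma> -` S" using openE by blast
    have \<gamma>S: "\<gamma> t \<in> S" if "t \<in> ball 0 r" for t using r(2) that by blast
    define F where "F j t = f (\<gamma> t) $ j" for j t
    define G where "G x t = affine_lift l (g (\<gamma> t)) $ x" for x t
    have F': "(F j has_field_derivative ?f' (\<gamma> t) e $ j) (at t)" if "t \<in> ball 0 r" for t j
      using holomorphic_map_on_line(1)[OF f \<gamma>S[OF that, unfolded \<gamma>_def]]
      unfolding F_def \<gamma>_def by blast
    have G': "(G x has_field_derivative ?dl (?g' (\<gamma> t) e) $ x) (at t)" if "t \<in> ball 0 r" for t x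
    proof -
      have g': "((\<lambda>t. g (\<gamma> t) $ i) has_field_derivative ?g' (\<gamma> t) e $ i) (at t)" for i
        using holomorphic_map_on_line(1)[OF g \<gamma>S[OF that, unfolded \<gamma>_def]] unfolding \<gamma>_def by blast
      show ?thesis
        using g' unfolding G_def affine_lift_deriv_def affine_lift_def
        by (cases x; cases "x = l") auto
    qed
    have dF: "deriv (F j) t = ?f' (\<gamma> t) e $ j" and dG: "deriv (G x) t = ?dl (?g' (\<gamma> t) e) $ x"
      if "t \<in> ball 0 r" for t j x
      using F'[OF that] G'[OF that] by (auto intro: DERIV_imp_deriv)
    have sumF: "(\<Sum>j\<in>UNIV. \<epsilon>E s j * deriv (F j) t * cnj (deriv (F j) t)) = herm (\<epsilon>E s) (?f' (\<gamma> t) e) (?f' (\<gamma> t) e)"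
      and sumG: "(\<Sum>x\<in>UNIV. \<epsilon>P \<sigma> x * G x t * cnj (G x t)) =
          herm (\<epsilon>P \<sigma>) (affine_lift l (g (\<gamma> t))) (affine_lift l (g (\<gamma> t)))"
        "(\<Sum>x\<in>UNIV. \<epsilon>P \<sigma> x * deriv (G x) t * cnj (deriv (G x) t)) =
          herm (\<epsilon>P \<sigma>) (?dl (?g' (\<gamma> t) e)) (?dl (?g' (\<gamma> t) e))"
        "(\<Sum>x\<in>UNIV. \<epsilon>P \<sigma> x * deriv (G x) t * cnj (G x t)) =
          herm (\<epsilon>P \<sigma>) (?dl (?g' (\<gamma> t) e)) (affine_lift l (g (\<gamma> t)))"
        "(\<Sum>x\<in>UNIV. \<epsilon>P \<sigma> x * G x t * cnj (deriv (G x) t)) =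
          herm (\<epsilon>P \<sigma>) (affine_lift l (g (\<gamma> t))) (?dl (?g' (\<gamma> t) e))"
      if "t \<in> ball 0 r" for t
      unfolding herm_def dF[OF that] dG[OF that] by (simp_all add: G_def)
    have nz: "herm (\<epsilon>P \<sigma>) (affine_lift l (g (\<gamma> t))) (affine_lift l (g (\<gamma> t))) \<noteq> 0" if "t \<in> ball 0 r" for t
      unfolding homogeneous_form_herm[symmetric] using pos[OF \<gamma>S[OF that]] by simp
    have "(\<Sum>j\<in>UNIV. \<epsilon>E s j * deriv (F j) 0 * cnj (deriv (F j) 0)) = 0"
    \<comment> \<open>The logarithmic form carries the factor \<open>c\<close>, so the flat side is
      multiplied by \<open>1 / c\<close>.\<close>
    proof (rule null_line_if_equal_metrics[where r = r and b = "1 / c" and g = G and \<eta> = "\<epsilon>P \<sigma>" and I = UNIV])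
      show "F j holomorphic_on ball 0 r" for j
        unfolding holomorphic_on_open[OF open_ball] using F' by blast
      show "G x holomorphic_on ball 0 r" for x
        unfolding holomorphic_on_open[OF open_ball] using G' by blast
      show "(\<Sum>x\<in>UNIV. \<epsilon>P \<sigma> x * G x 0 * cnj (G x 0)) \<noteq> 0"
        using sumG(1)[of 0] nz[of 0] r(1) by simp
    next
      fix t :: complex assume t: "t \<in> ball 0 r"
      have solve: "complex_of_real (1 / c) * A * Q\<^sup>2 = B * Q - C * E"
        if "2 * A = of_real c * (2 * (B / Q - C * E / Q\<^sup>2))" "Q \<noteq> 0" for A B C E Q
      proof -
        have "2 * A = 2 * (of_real c * (B / Q - C * E / Q\<^sup>2))"
          unfolding that(1) by (rule mult.left_commute)
        then have "A = of_real c * (B / Q - C * E / Q\<^sup>2)" by (simp only: mult_cancel_left) simp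
        then show ?thesis using that(2) c by (simp add: field_simps power2_eq_square)
      qed
      have fi: "?f' (\<gamma> t) (\<i> *s e) = \<i> *s ?f' (\<gamma> t) e" and gi: "?g' (\<gamma> t) (\<i> *s e) = \<i> *s ?g' (\<gamma> t) e"
        using holomorphic_map_on_line(2)[OF f \<gamma>S[OF t, unfolded \<gamma>_def]]
          holomorphic_map_on_line(2)[OF g \<gamma>S[OF t, unfolded \<gamma>_def]] unfolding \<gamma>_def by blast+
      have "\<omega> (\<gamma> t) e (\<i> *s e) = 2 * herm (\<epsilon>E s) (?f' (\<gamma> t) e) (?f' (\<gamma> t) e)"
        unfolding \<omega>f[OF \<gamma>S[OF t], symmetric] fi i_ddbar_euclidean_form(2) ..
      moreover note \<omega>g[OF \<gamma>S[OF t], of e "\<i> *s e", symmetric, unfolded gi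
          i_ddbar_ln_homogeneous_form[OF pos[OF \<gamma>S[OF t]]]]
      ultimately show "complex_of_real (1 / c) * (\<Sum>j\<in>UNIV. \<epsilon>E s j * deriv (F j) t * cnj (deriv (F j) t)) *
          (\<Sum>x\<in>UNIV. \<epsilon>P \<sigma> x * G x t * cnj (G x t))\<^sup>2 =
        (\<Sum>x\<in>UNIV. \<epsilon>P \<sigma> x * deriv (G x) t * cnj (deriv (G x) t)) * (\<Sum>x\<in>UNIV. \<epsilon>P \<sigma> x * G x t * cnj (G x t)) -
        (\<Sum>x\<in>UNIV. \<epsilon>P \<sigma> x * deriv (G x) t * cnj (G x t)) * (\<Sum>x\<in>UNIV. \<epsilon>P \<sigma> x * G x t * cnj (deriv (G x) t))"
        unfolding sumF[OF t] sumG[OF t] by (intro solve nz[OF t]) simp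
    qed (use r c in auto)
    then show ?thesis using sumF[of 0] r(1) by (simp add: \<gamma>_def)
  qed
  moreover have "sesquilinear (\<lambda>u v. herm (\<epsilon>E s) (?f' z u) (?f' z v))"
  proof -
    obtain f' where f': "(f has_derivative f') (at z)" "\<And>c v. f' (c *s v) = c *s f' v"
      using f S(2) unfolding holomorphic_map_on_def by blast
    have "?f' z = f'" using frechet_derivative_at[OF f'(1)] by simp
    then show ?thesis
      using sesquilinear_herm_linear(1)[OF _ f'(2)] linear_add[OF has_derivative_linear[OF f'(1)]] by simp
  qed
  ultimately have "herm (\<epsilon>E s) (?f' z u) (?f' z v) = 0" for u v
    by (rule sesquilinear_eq_0[rotated])
  then have "\<omega> z u v = 0" for u v
    unfolding \<omega>f[OF S(2), symmetric] i_ddbar_euclidean_form(1) by simp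
  \<comment> \<open>Here \<open>1\<close> is the all-ones vector, nonzero because the dimension is
    positive.\<close>
  then have "(1 :: complex^'d) = 0" by (rule nondeg)
  then show False by simp
qed

section \<open>Projective charts\<close>

lemma open_homogeneous_form_pos: "open {\<xi>. homogeneous_form s \<xi> > 0}"
  unfolding homogeneous_form_def by (intro open_Collect_less continuous_intros)

lemma topspace_proj_topology:
  "topspace (proj_topology s :: (complex^('n::finite option)) set topology) = proj_points s"
proof
  show "topspace (proj_topology s :: (complex^('n option)) set topology) \<subseteq> proj_points s"
    using openin_topspace[of "proj_topology s :: (complex^('n option)) set topology"] unfolding openin_proj_topology by blast
  have "{\<xi> :: complex^('n option). homogeneous_form s \<xi> > 0 \<and> proj_class \<xi> \<in> proj_points s} =
      {\<xi>. homogeneous_form s \<xi> > 0}"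
    by (auto simp: proj_points_def)
  then have "openin (proj_topology s) (proj_points s :: (complex^('n option)) set set)"
    unfolding openin_proj_topology by (simp add: open_homogeneous_form_pos)
  then show "proj_points s \<subseteq> topspace (proj_topology s :: (complex^('n option)) set topology)" by (rule openin_subset)
qed

lemma proj_class_self: "\<xi> \<in> proj_class \<xi>"
  unfolding proj_class_def by (rule CollectI, rule exI[of _ 1]) simp

lemma openin_affine_domain:
  fixes l :: "'n::finite option"
  shows "openin (proj_topology s) {P \<in> proj_points s. \<forall>\<xi>\<in>P. \<xi> $ l \<noteq> 0}"
proof -
  have "(\<forall>\<zeta>\<in>proj_class \<xi>. \<zeta> $ l \<noteq> 0) \<longleftrightarrow> \<xi> $ l \<noteq> 0" for \<xi> :: "complex^('n option)"
    using proj_class_self[of \<xi>] unfolding proj_class_def by auto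
  then have "{\<xi>. homogeneous_form s \<xi> > 0 \<and> proj_class \<xi> \<in> {P \<in> proj_points s. \<forall>\<xi>\<in>P. \<xi> $ l \<noteq> 0}} =
      {\<xi>. homogeneous_form s \<xi> > 0} \<inter> {\<xi>. \<xi> $ l \<noteq> 0}"
    by (auto simp: proj_points_def)
  moreover have "open {\<xi> :: complex^('n option). \<xi> $ l \<noteq> 0}"
    by (intro open_Collect_neq continuous_intros)
  ultimately show ?thesis
    unfolding openin_proj_topology by (simp add: open_Int open_homogeneous_form_pos)
qed

lemma affine_lift_affine_coord: "\<xi> $ l \<noteq> 0 \<Longrightarrow> affine_lift l (affine_coord l \<xi>) = (1 / \<xi> $ l) *s \<xi>"
  by (auto simp: affine_lift_def affine_coord_def vec_eq_iff split: option.split)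

text \<open>The representative picked by \<open>SOME\<close> and its normalisation are nonzero
  multiples of a positive vector, and scaling multiplies the form by a positive factor.\<close>

lemma homogeneous_form_affine_coord_pos:
  assumes "P \<in> proj_points s" "\<forall>\<xi>\<in>P. \<xi> $ l \<noteq> 0"
  shows "homogeneous_form s (affine_lift l (affine_coord l (SOME \<xi>. \<xi> \<in> P))) > 0"
proof -
  obtain \<xi> where \<xi>: "homogeneous_form s \<xi> > 0" "P = proj_class \<xi>"
    using assms(1) unfolding proj_points_def by blast
  define \<zeta> where "\<zeta> = (SOME \<xi>. \<xi> \<in> P)"
  have \<zeta>: "\<zeta> \<in> P" unfolding \<zeta>_def using proj_class_self \<xi>(2) by (metis someI)
  then obtain c where "\<zeta> = c *s \<xi>" "c \<noteq> 0" unfolding \<xi>(2) proj_class_def by blast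
  moreover have "\<zeta> $ l \<noteq> 0" using \<zeta> assms(2) by blast
  ultimately show ?thesis
    using \<xi>(1) unfolding \<zeta>_def[symmetric]
    by (simp add: affine_lift_affine_coord homogeneous_form_scale)
qed

text \<open>A vector on which the form is positive is not zero, and nonzero multiples keep its
  nonzero coordinates.\<close>

lemma proj_point_in_affine_domain:
  assumes "P \<in> proj_points s"
  shows "\<exists>l. \<forall>\<xi>\<in>P. \<xi> $ l \<noteq> 0"
proof -
  obtain \<xi> where \<xi>: "homogeneous_form s \<xi> > 0" "P = proj_class \<xi>"
    using assms unfolding proj_points_def by blast
  have "\<exists>l. \<xi> $ l \<noteq> 0"
  proof (rule ccontr)
    assume "\<nexists>l. \<xi> $ l \<noteq> 0"
    then show False using \<xi>(1) by (simp add: homogeneous_form_def)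
  qed
  then show ?thesis unfolding \<xi>(2) proj_class_def by auto
qed

section \<open>Reduction from manifolds to charts\<close>

text \<open>The factor \<open>c\<close> may have either sign, so one statement serves the projective
  and the hyperbolic metrics. Near one point of \<open>U\<close>, a chart of \<open>D\<close> and an
  affine chart reduce it to \<open>local_pullbacks_differ\<close>.\<close>

lemma no_common_open_submanifold:
  fixes D :: "('p, 'i, 'd::finite) kmfd" and X :: "(complex^'n, unit, 'n::finite) kmfd"
    and Y :: "((complex^('m option)) set, 'm option, 'm::finite) kmfd"
  assumes F: "kahler_submanifold D (complex_euclidean s :: (complex^'n, unit, 'n) kmfd) F"
    and U: "openin (topo D) U" "U \<noteq> {}"
    and G: "kahler_submanifold (restrict_kmfd D U) Y G"
    and c: "c \<noteq> 0"
    and Y: "Y = (complex_projective \<sigma> b)\<lparr>form := (\<lambda>l w u v. of_real c *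
      i_ddbar (\<lambda>w. of_real (ln (homogeneous_form \<sigma> (affine_lift l w)))) w u v)\<rparr>"
  shows False
proof -
  let ?X = "complex_euclidean s :: (complex^'n, unit, 'n) kmfd" and ?M = "restrict_kmfd D U"
  have D: "complex_manifold D" "\<And>i. indefinite_kahler_form_on (coord D i ` dom D i) (form D i)"
    and pF: "pulls_back_form D ?X F" and hF: "holomorphic_charts D ?X F"
    using F unfolding kahler_submanifold_def indefinite_kahler_manifold_def holomorphic_immersion_def
    by blast+
  have pG: "pulls_back_form ?M Y G" and hG: "holomorphic_charts ?M Y G"
    and cG: "continuous_map (topo ?M) (topo Y) G"
    using G unfolding kahler_submanifold_def holomorphic_immersion_def by blast+
  have Xsimps: "dom ?X () = UNIV" "coord ?X () = (\<lambda>z. z)"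
    "form ?X () = i_ddbar (\<lambda>z. of_real (euclidean_form s z))"
    by (simp_all add: complex_euclidean_def)
  have Ysimps: "topo Y = proj_topology \<sigma>" "\<And>l. dom Y l = {P \<in> proj_points \<sigma>. \<forall>\<xi>\<in>P. \<xi> $ l \<noteq> 0}"
    "\<And>l P. coord Y l P = affine_coord l (SOME \<xi>. \<xi> \<in> P)"
    "\<And>l w u v. form Y l w u v = of_real c *
       i_ddbar (\<lambda>w. of_real (ln (homogeneous_form \<sigma> (affine_lift l w)))) w u v"
    by (simp_all add: Y complex_projective_def)
  have Msimps: "topo ?M = subtopology (topo D) U" "\<And>i. dom ?M i = dom D i \<inter> U"
    "\<And>i. coord ?M i = coord D i" "\<And>i. form ?M i = form D i"
    by (simp_all add: restrict_kmfd_def)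
  obtain p where p: "p \<in> U" using U(2) by blast
  then have "p \<in> points D" using openin_subset[OF U(1)] by blast
  then obtain i where i: "p \<in> dom D i" using D(1) unfolding complex_manifold_def by blast
  have chart: "openin (topo D) (dom D i)" "open (coord D i ` dom D i)"
    "homeomorphic_map (subtopology (topo D) (dom D i)) (top_of_set (coord D i ` dom D i)) (coord D i)"
    using D(1) unfolding complex_manifold_def by blast+
  have inj: "inj_on (coord D i) (dom D i)"
    using homeomorphic_imp_injective_map[OF chart(3)] openin_subset[OF chart(1)]
    by (simp add: topspace_subtopology Int_absorb1)
  have "G p \<in> topspace (topo Y)"
    using continuous_map_image_subset_topspace[OF cG] p openin_subset[OF U(1)]
    unfolding Msimps topspace_subtopology by blast
  then have "G p \<in> proj_points \<sigma>" unfolding Ysimps topspace_proj_topology .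
  then obtain l where l: "G p \<in> dom Y l" using proj_point_in_affine_domain unfolding Ysimps by blast
  define W where "W = {p \<in> dom D i \<inter> U. G p \<in> dom Y l}"
  define S where "S = coord D i ` W"
  have "openin (topo Y) (dom Y l)" unfolding Ysimps by (rule openin_affine_domain)
  from openin_continuous_map_preimage[OF cG this]
  have "openin (topo D) {p \<in> topspace (topo D) \<inter> U. G p \<in> dom Y l}"
    unfolding Msimps topspace_subtopology using openin_open_subtopology[OF U(1)] by blast
  then have "openin (topo D) (dom D i \<inter> {p \<in> topspace (topo D) \<inter> U. G p \<in> dom Y l})"
    using chart(1) by blast
  also have "dom D i \<inter> {p \<in> topspace (topo D) \<inter> U. G p \<in> dom Y l} = W"
    using openin_subset[OF chart(1)] by (auto simp: W_def)
  finally have "openin (subtopology (topo D) (dom D i)) W"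
    using openin_open_subtopology[OF chart(1)] by (simp add: W_def)
  then have "openin (top_of_set (coord D i ` dom D i)) S"
    using homeomorphic_imp_open_map[OF chart(3)] unfolding open_map_def S_def by blast
  then have "open S" using chart(2) openin_open_trans by blast
  moreover have "coord D i p \<in> S" using i p l by (simp add: S_def W_def)
  moreover have S_F: "S \<subseteq> rep_dom D ?X F i ()" by (auto simp: S_def W_def rep_dom_def Xsimps)
  moreover have S_G: "S = rep_dom ?M Y G i l" by (simp add: S_def W_def rep_dom_def Msimps)
  ultimately show False
  proof (rule_tac local_pullbacks_differ[where S = S and z = "coord D i p" and c = c and \<sigma> = \<sigma> and l = l
        and s = s and f = "coord_rep D ?X F i ()" and g = "coord_rep ?M Y G i l" and \<omega> = "form D i"])
    show "holomorphic_map_on (coord_rep D ?X F i ()) S"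
      using hF S_F unfolding holomorphic_charts_def holomorphic_map_on_def by blast
    show "holomorphic_map_on (coord_rep ?M Y G i l) S"
      using hG unfolding holomorphic_charts_def S_G by blast
    show "homogeneous_form \<sigma> (affine_lift l (coord_rep ?M Y G i l y)) > 0" if y: "y \<in> S" for y
    proof -
      obtain r where r: "r \<in> dom D i \<inter> U" "G r \<in> dom Y l" "y = coord D i r"
        using y by (auto simp: S_def W_def)
      \<comment> \<open>The chart of the restricted manifold is inverted on the smaller domain;
        injectivity on \<open>dom D i\<close> still identifies the preimage.\<close>
      have "inv_into (dom D i \<inter> U) (coord D i) y = r"
        unfolding r(3) by (rule inv_into_f_f[OF _ r(1)]) (use inj in \<open>auto intro: inj_on_subset\<close>)
      then have "coord_rep ?M Y G i l y = affine_coord l (SOME \<xi>. \<xi> \<in> G r)"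
        by (simp add: coord_rep_def Msimps Ysimps)
      then show ?thesis using homogeneous_form_affine_coord_pos r(2) unfolding Ysimps by auto
    qed
    show "i_ddbar (\<lambda>z. of_real (euclidean_form s z)) (coord_rep D ?X F i () y)
      (frechet_derivative (coord_rep D ?X F i ()) (at y) u)
      (frechet_derivative (coord_rep D ?X F i ()) (at y) v) = form D i y u v" if "y \<in> S" for y u v
      using pF S_F that unfolding pulls_back_form_def Xsimps[symmetric] by blast
    show "of_real c * i_ddbar (\<lambda>w. of_real (ln (homogeneous_form \<sigma> (affine_lift l w))))
      (coord_rep ?M Y G i l y) (frechet_derivative (coord_rep ?M Y G i l) (at y) u)
      (frechet_derivative (coord_rep ?M Y G i l) (at y) v) = form D i y u v" if "y \<in> S" for y u v
      using pG that unfolding pulls_back_form_def Ysimps(4)[symmetric] S_G Msimps(4)[symmetric] by blast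
    show "u = 0" if "\<And>v. form D i (coord D i p) u v = 0" for u
      using D(2)[of i] that i unfolding indefinite_kahler_form_on_def by blast
  qed (use c in auto)
qed

text \<open>Makes the claim on \<open>relatives\<close> the case \<open>U = points D\<close> of the
  claim on open subsets.\<close>

lemma restrict_kmfd_points:
  assumes "complex_manifold D"
  shows "restrict_kmfd D (points D) = D"
proof -
  have "dom D i \<inter> points D = dom D i" for i
    using assms unfolding complex_manifold_def by blast
  then show ?thesis by (simp add: restrict_kmfd_def)
qed

theorem corollary2p2:
  fixes s s' :: nat
  assumes "s \<le> CARD('n)" and "s' \<le> CARD('m)"
  shows
    "(\<forall>(D :: ('p, 'i, 'd::finite) kmfd) F.
        kahler_submanifold D (complex_euclidean s :: (complex^'n, unit, 'n::finite) kmfd) F \<longrightarrow>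
        (\<forall>U. openin (topo D) U \<and> U \<noteq> {} \<longrightarrow>
          (\<forall>b>0. \<not> (\<exists>G. kahler_submanifold (restrict_kmfd D U)
            (complex_projective s' b :: (_, _, 'm::finite) kmfd) G)) \<and>
          (\<forall>b<0. \<not> (\<exists>G. kahler_submanifold (restrict_kmfd D U)
            (complex_hyperbolic s' b :: (_, _, 'm) kmfd) G))))
     \<and> (\<forall>b>0. \<not> relatives TYPE(('p, 'i, 'd) kmfd)
          (complex_euclidean s :: (complex^'n, unit, 'n) kmfd)
          (complex_projective s' b :: (_, _, 'm) kmfd))
     \<and> (\<forall>b<0. \<not> relatives TYPE(('p, 'i, 'd) kmfd)
          (complex_euclidean s :: (complex^'n, unit, 'n) kmfd)
          (complex_hyperbolic s' b :: (_, _, 'm) kmfd))"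
proof -
  let ?E = "complex_euclidean s :: (complex^'n, unit, 'n) kmfd"
  have proj: "(complex_projective s' b :: (_, _, 'm) kmfd) = (complex_projective s' b)\<lparr>form := (\<lambda>l w u v. of_real (1 / b) *
      i_ddbar (\<lambda>w. of_real (ln (homogeneous_form s' (affine_lift l w)))) w u v)\<rparr>" for b
    by (simp add: complex_projective_def)
  \<comment> \<open>Since \<open>- (1 / (- b)) = 1 / b\<close>, the hyperbolic metric is the
    logarithmic form of complementary index with the negative factor \<open>1 / b\<close>.\<close>
  have hyp: "(complex_hyperbolic s' b :: (_, _, 'm) kmfd) = (complex_projective (CARD('m) - s') (- b))\<lparr>form := (\<lambda>l w u v. of_real (1 / b) *
      i_ddbar (\<lambda>w. of_real (ln (homogeneous_form (CARD('m) - s') (affine_lift l w)))) w u v)\<rparr>" for b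
    by (simp add: complex_hyperbolic_def)
  have P: False if "kahler_submanifold D ?E F" "openin (topo D) U" "U \<noteq> {}"
      "kahler_submanifold (restrict_kmfd D U) (complex_projective s' b :: (_, _, 'm) kmfd) G" "b > 0"
    for D :: "('p, 'i, 'd) kmfd" and F G U b
    using no_common_open_submanifold[OF that(1-4) _ proj] that(5) by simp
  have H: False if "kahler_submanifold D ?E F" "openin (topo D) U" "U \<noteq> {}"
      "kahler_submanifold (restrict_kmfd D U) (complex_hyperbolic s' b :: (_, _, 'm) kmfd) G" "b < 0"
    for D :: "('p, 'i, 'd) kmfd" and F G U b
    using no_common_open_submanifold[OF that(1-4) _ hyp] that(5) by simp
  have R: "restrict_kmfd D (points D) = D" if "kahler_submanifold D ?E F"
    for D :: "('p, 'i, 'd) kmfd" and F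
    using that restrict_kmfd_points
    unfolding kahler_submanifold_def indefinite_kahler_manifold_def by blast
  have "\<not> relatives TYPE(('p, 'i, 'd) kmfd) ?E (complex_projective s' b :: (_, _, 'm) kmfd)" if "b > 0" for b
    unfolding relatives_def using P[OF _ openin_topspace _ _ that] R by metis
  moreover have "\<not> relatives TYPE(('p, 'i, 'd) kmfd) ?E (complex_hyperbolic s' b :: (_, _, 'm) kmfd)" if "b < 0" for b
    unfolding relatives_def using H[OF _ openin_topspace _ _ that] R by metis
  ultimately show ?thesis using P H by blast
qed

end
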